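(* For each $k\in\mathbb{N}$, there are (up to isomorphism) only finitely many $k$-vertex-critical (co-gem, paraglider)-free graphs.
   Context: All graphs are finite, simple and undirected; $\mathbb{N}=\{1,2,3,\ldots\}$. A graph $G$ is $k$-vertex-critical if $\chi(G)=k$ and $\chi(G-v)<k$ for all $v\in V(G)$, where $\chi$ is the chromatic number. A graph is $(H_1,H_2)$-free if it contains neither $H_1$ nor $H_2$ as an induced subgraph. The co-gem is $P_4+P_1$, the disjoint union of a chordless path on four vertices and an isolated vertex. The paraglider is the complement of $P_2+P_3$; equivalently, the five-vertex graph with vertices $a,b,c,x,y$ and edges $ab, ax, ay, bx, by, cx, cy$. *)

theory Defs
  imports "Graph_Theory.Graph_Theory"
begin

text \<open>
  A finite simple undirected graph is a \<^locale>\<open>pair_graph\<close>: finite, loop-free, without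
  parallel arcs, each edge being represented by its two opposite arcs.
\<close>

definition proper_colouring :: "('a, 'b) pre_digraph \<Rightarrow> nat \<Rightarrow> ('a \<Rightarrow> nat) \<Rightarrow> bool" where
  "proper_colouring G k c \<longleftrightarrow>
     (\<forall>v \<in> verts G. c v < k) \<and> (\<forall>u v. u \<rightarrow>\<^bsub>G\<^esub> v \<longrightarrow> c u \<noteq> c v)"

text \<open>Meaningful for finite loop-free graphs, where some proper colouring exists.\<close>

definition chromatic_number :: "('a, 'b) pre_digraph \<Rightarrow> nat" where
  "chromatic_number G = (LEAST k. \<exists>c. proper_colouring G k c)"

definition vertex_critical :: "nat \<Rightarrow> ('a, 'b) pre_digraph \<Rightarrow> bool" where
  "vertex_critical k G \<longleftrightarrow>
     chromatic_number G = k \<and>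
     (\<forall>v \<in> verts G. chromatic_number (pre_digraph.del_vert G v) < k)"

definition induced_free :: "('c, 'd) pre_digraph \<Rightarrow> ('a, 'b) pre_digraph \<Rightarrow> bool" where
  "induced_free H G \<longleftrightarrow> \<not> (\<exists>K. induced_subgraph K G \<and> digraph_iso K H)"

definition undirected :: "'a set \<Rightarrow> ('a \<times> 'a) set \<Rightarrow> 'a pair_pre_digraph" where
  "undirected V E = \<lparr> pverts = V, parcs = E \<union> E\<inverse> \<rparr>"

text \<open>The path $0, 1, 2, 3$ together with the isolated vertex $4$.\<close>

definition co_gem :: "nat pair_pre_digraph" where
  "co_gem = undirected {0, 1, 2, 3, 4} {(0, 1), (1, 2), (2, 3)}"

text \<open>The vertices $a, b, c, x, y$ are numbered $0, 1, 2, 3, 4$.\<close>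

definition paraglider :: "nat pair_pre_digraph" where
  "paraglider = undirected {0, 1, 2, 3, 4}
     {(0, 1), (0, 3), (0, 4), (1, 3), (1, 4), (2, 3), (2, 4)}"

lemma pair_graph_undirected:
  assumes "finite V" "E \<subseteq> V \<times> V" "\<forall>(u, v) \<in> E. u \<noteq> v"
  shows "pair_graph (undirected V E)"
proof -
  have "finite E" using assms(1,2) by (meson finite_SigmaI finite_subset)
  moreover have "sym (E \<union> E\<inverse>)" by (rule sym_Un_converse)
  ultimately show ?thesis
    using assms by unfold_locales (auto simp: undirected_def symmetric_def)
qed

lemma pair_graph_co_gem: "pair_graph co_gem"
  unfolding co_gem_def by (rule pair_graph_undirected) simp_all

lemma pair_graph_paraglider: "pair_graph paraglider"
  unfolding paraglider_def by (rule pair_graph_undirected) simp_all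

lemma proper_colouring_exists:
  assumes "finite (verts G)" "loopfree_digraph G"
  shows "\<exists>k c. proper_colouring G k c"
proof -
  interpret loopfree_digraph G by fact
  obtain c :: "'a \<Rightarrow> nat" and n where c: "c ` verts G = {i. i < n}" "inj_on c (verts G)"
    using finite_imp_inj_to_nat_seg[OF assms(1)] by metis
  have "proper_colouring G n c"
    unfolding proper_colouring_def
  proof (intro conjI ballI allI impI)
    fix v assume "v \<in> verts G" then show "c v < n" using c(1) by blast
  next
    fix u v assume uv: "u \<rightarrow>\<^bsub>G\<^esub> v"
    then have "u \<in> verts G" "v \<in> verts G" by (auto dest: adj_in_verts)
    moreover have "u \<noteq> v" using uv adj_not_same by blast
    ultimately show "c u \<noteq> c v" using c(2) by (meson inj_onD)
  qed
  then show ?thesis by blast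
qed

end

theory Submission
  imports Defs "HOL-Library.Ramsey"
begin

text \<open>
  Put \<open>m = k - 1\<close>.  A \<open>k\<close>-vertex-critical graph on more than \<open>k\<close> vertices has no clique on
  \<open>m + 1\<close> vertices, so by Ramsey's theorem it suffices to bound its independent sets.  An independent
  set is a family of pairwise anticomplete cliques of size 1.  The proof shows that a large family of
  pairwise anticomplete \<open>t\<close>-cliques produces a family of pairwise anticomplete \<open>(t + 1)\<close>-cliques
  that is still large (\<open>clique_family_step\<close>).  After \<open>m\<close> such steps there would be an
  \<open>(m + 1)\<close>-clique, so the family at the start was small.

  Growing the cliques has two ingredients.  The first is that criticality separates the cliques, once
  boundedly many types and exceptions are taken care of: for any two of many cliques, \<open>K r\<close> and
  \<open>K s\<close>, some vertex is complete to \<open>K r\<close> and anticomplete to \<open>K s\<close>.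
  For \<open>t = 1\<close> this says that nonadjacent vertices have incomparable neighbourhoods
  (\<open>undominated_vertex\<close>).  For \<open>t \<ge> 2\<close> the co-gem forces a rigid shape.  Call a vertex shared
  if it has neighbours in two of the cliques.  The vertices that are not shared form regions around
  the cliques, with no edges between distinct regions.  A shared vertex with no neighbour in at least
  two of the cliques is complete or anticomplete to each region; if it misses only one clique, this
  can fail for the region of that clique, but few cliques are missed in this way.  The vertices with
  neighbours in all cliques, the hubs, form a clique by the exclusion of the paraglider.  So there are
  boundedly many hubs and boundedly many types of colouring constraints that they put on a region.
  If two regions have the same type and no shared vertex separates them, then the first region can be
  recoloured with the colours of the second, and the whole graph has an \<open>m\<close>-colouring, a
  contradiction (\<open>recolouring_separates\<close>).

  The second ingredient turns pairwise separation into an induced matching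
  (\<open>induced_matching_exists\<close>).  In a co-gem-free graph the traces of vertices on an independent set
  form a cross-free family: any two of them are nested, disjoint, or jointly cover the set.  If some
  trace is large but not everything, pass to it.  This cannot go on for long, because a long descent
  contains a large co-matching, which criticality and the two forbidden graphs exclude
  (\<open>co_matching_bounded\<close>).  Once all traces are small, the maximal ones are disjoint, and their
  vertices, added to the cliques, give the larger cliques.
\<close>

section \<open>Ramsey numbers and the pigeonhole principle\<close>

lemma ramsey_relation:
  fixes R :: "'i \<Rightarrow> 'i \<Rightarrow> bool"
  assumes sym: "\<And>i j. R i j \<Longrightarrow> R j i" and fin: "finite I" and card: "ES 2 a b \<le> card I"
  obtains J where "J \<subseteq> I" "card J = a" "\<And>i j. i \<in> J \<Longrightarrow> j \<in> J \<Longrightarrow> i \<noteq> j \<Longrightarrow> R i j"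
        | J where "J \<subseteq> I" "card J = b" "\<And>i j. i \<in> J \<Longrightarrow> j \<in> J \<Longrightarrow> i \<noteq> j \<Longrightarrow> \<not> R i j"
proof -
  let ?N = "card I"
  obtain g where g: "bij_betw g {..<?N} I"
    using ex_bij_betw_nat_finite[OF fin] by (auto simp: atLeast0LessThan)
  have "partn_lst {..<?N} [a, b] 2"
    using partn_lst_greater_resource[OF ramsey2_full card] .
  moreover define f where "f e = (if \<exists>i j. e = {i, j} \<and> R (g i) (g j) then 0 else 1::nat)" for e
  have "f \<in> nsets {..<?N} 2 \<rightarrow> {..<length [a, b]}" by (auto simp: f_def)
  ultimately obtain t where t: "t < length [a, b]" "monochromatic {..<?N} ([a, b] ! t) 2 f t"
    unfolding partn_lst_def by (meson bspec)
  then obtain H where H: "H \<in> nsets {..<?N} ([a, b] ! t)" "f ` nsets H 2 \<subseteq> {t}"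
    unfolding monochromatic_def by blast
  have HI: "H \<subseteq> {..<?N}" "card H = [a, b] ! t" using H(1) by (auto simp: nsets_def)
  have inj: "inj_on g H" using g HI by (meson bij_betw_imp_inj_on inj_on_subset)
  have J: "g ` H \<subseteq> I" using g HI by (auto simp: bij_betw_def)
  have cJ: "card (g ` H) = [a, b] ! t" using inj HI by (simp add: card_image)
  have ft: "f {i, j} = t" if "i \<in> H" "j \<in> H" "i \<noteq> j" for i j
    using H(2) that by (auto simp: image_subset_iff)
  have fR: "f {i, j} = 0 \<longleftrightarrow> R (g i) (g j)" for i j
    unfolding f_def using sym by (auto simp: doubleton_eq_iff)
  show thesis
  proof (cases "t = 0")
    case True
    show thesis
    proof (rule that(1)[OF J])
      show "R i j" if ij: "i \<in> g ` H" "j \<in> g ` H" "i \<noteq> j" for i j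
      proof -
        obtain x y where xy: "x \<in> H" "y \<in> H" "i = g x" "j = g y" using ij(1,2) by blast
        then have "x \<noteq> y" using ij(3) by blast
        then show ?thesis using ft[OF xy(1,2)] fR[of x y] True xy by simp
      qed
    qed (use cJ True in simp)
  next
    case False
    then have "t = 1" using t by auto
    show thesis
    proof (rule that(2)[OF J])
      show "\<not> R i j" if ij: "i \<in> g ` H" "j \<in> g ` H" "i \<noteq> j" for i j
      proof -
        obtain x y where xy: "x \<in> H" "y \<in> H" "i = g x" "j = g y" using ij(1,2) by blast
        then have "x \<noteq> y" using ij(3) by blast
        then show ?thesis using ft[OF xy(1,2)] fR[of x y] False xy by simp
      qed
    qed (use cJ \<open>t = 1\<close> in simp)
  qed
qed

lemma popular_fibre:
  assumes "finite X" "finite C" "f ` X \<subseteq> C" "d * card C < card X"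
  obtains c where "c \<in> C" "d < card {x \<in> X. f x = c}"
proof (rule ccontr)
  assume "\<not> thesis"
  then have le: "card {x \<in> X. f x = c} \<le> d" if "c \<in> C" for c
    using that not_le_imp_less \<open>\<And>c. c \<in> C \<Longrightarrow> d < card {x \<in> X. f x = c} \<Longrightarrow> thesis\<close> by blast
  have X: "X = (\<Union>c\<in>C. {x \<in> X. f x = c})" using assms(3) by auto
  have "card X \<le> (\<Sum>c\<in>C. card {x \<in> X. f x = c})"
    by (subst X, rule card_UN_le[OF assms(2)])
  also have "\<dots> \<le> d * card C" using sum_bounded_above[of C _ d] le by (simp add: mult.commute)
  finally show False using assms(4) by simp
qed

section \<open>Critical graphs\<close>

text \<open>
  By Ramsey's theorem, a descent of this length would contain a co-matching that exceeds the bound of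
  \<open>co_matching_bounded\<close> by one.
\<close>
definition descent_depth :: "nat \<Rightarrow> nat" where
  "descent_depth m = ES 2 (Suc m) (m * m + 2 * m + 2)"

text \<open>
  The size that an independent set needs in \<open>matching_or_descent\<close> for \<open>n\<close> edges or \<open>p\<close> steps.  If
  \<open>d = descent_bound n p\<close> exceeds the size of all traces, then \<open>n * d\<close> vertices are enough for \<open>n\<close>
  disjoint traces, and \<open>2 * d + 1\<close> vertices are enough to leave one outside of any two traces.
\<close>
fun descent_bound :: "nat \<Rightarrow> nat \<Rightarrow> nat" where
  "descent_bound n 0 = 1"
| "descent_bound n (Suc p) = n * descent_bound n p + 2 * descent_bound n p + 1"

lemma descent_bound_pos: "0 < descent_bound n p"
  by (induction p) auto

text \<open>
  The graphs of the theorem in terms of their adjacency relation, with \<open>m = k - 1\<close>.  The last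
  assumption leaves out the complete graph on \<open>m + 1\<close> vertices, the only critical graph that
  contains a clique of that size.  In the two conditions on forbidden graphs the stated edges and
  non-edges make the five vertices distinct, up to the explicit \<open>x \<noteq> y\<close>.
\<close>
locale critical_graph =
  fixes V :: "'a set" and adj :: "'a \<Rightarrow> 'a \<Rightarrow> bool" and m :: nat
  assumes finite_V: "finite V"
    and adj_V: "adj u v \<Longrightarrow> u \<in> V"
    and adj_sym: "adj u v \<Longrightarrow> adj v u"
    and irrefl: "\<not> adj v v"
    and not_colourable:
      "\<not> (\<exists>c. (\<forall>v\<in>V. c v < m) \<and> (\<forall>u\<in>V. \<forall>v\<in>V. adj u v \<longrightarrow> c u \<noteq> c v))"
    and critical: "q \<in> V \<Longrightarrow>
      \<exists>c. (\<forall>v\<in>V - {q}. c v < m) \<and> (\<forall>u\<in>V - {q}. \<forall>v\<in>V - {q}. adj u v \<longrightarrow> c u \<noteq> c v)"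
    and co_gem_free: "\<lbrakk>adj a b; adj b c; adj c d; z \<in> V; \<not> adj a c; \<not> adj a d; \<not> adj b d;
      \<not> adj a z; \<not> adj b z; \<not> adj c z; \<not> adj d z\<rbrakk> \<Longrightarrow> False"
    and paraglider_free: "\<lbrakk>adj a b; adj a x; adj a y; adj b x; adj b y; adj c x; adj c y;
      x \<noteq> y; \<not> adj x y; \<not> adj a c; \<not> adj b c\<rbrakk> \<Longrightarrow> False"
    and large: "Suc m < card V"
begin

lemma adj_commute: "adj u v \<longleftrightarrow> adj v u"
  using adj_sym by blast

text \<open>
  A clique on \<open>m + 1\<close> vertices would survive the deletion of a vertex outside of it, and the rest of
  the graph could not be \<open>m\<close>-colourable.
\<close>
lemma clique_card_le:
  assumes "X \<subseteq> V" "\<And>x y. x \<in> X \<Longrightarrow> y \<in> X \<Longrightarrow> x \<noteq> y \<Longrightarrow> adj x y"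
  shows "card X \<le> m"
proof (rule ccontr)
  assume "\<not> card X \<le> m"
  then obtain Y where Y: "Y \<subseteq> X" "card Y = Suc m"
    by (meson not_less_eq_eq obtain_subset_with_card_n)
  have YV: "Y \<subseteq> V" using Y assms(1) by blast
  have "Y \<noteq> V" using large Y by auto
  then obtain q where q: "q \<in> V" "q \<notin> Y" using YV by blast
  obtain c where c: "\<forall>v\<in>V - {q}. c v < m" "\<forall>u\<in>V - {q}. \<forall>v\<in>V - {q}. adj u v \<longrightarrow> c u \<noteq> c v"
    using critical[OF q(1)] by blast
  have sub: "Y \<subseteq> V - {q}" using YV q by blast
  then have "c ` Y \<subseteq> {..<m}" using c(1) by auto
  moreover have "inj_on c Y"
  proof (rule inj_onI)
    fix x y assume xy: "x \<in> Y" "y \<in> Y" "c x = c y"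
    then have "\<not> adj x y" using c(2) sub by blast
    then show "x = y" using assms(2)[of x y] Y(1) xy by blast
  qed
  ultimately have "card Y \<le> m" by (metis card_inj_on_le card_lessThan finite_lessThan)
  then show False using Y by simp
qed

text \<open>
  Otherwise a colouring of the graph without \<open>q\<close> extends to \<open>q\<close>: some colour occurs more than \<open>d\<close>
  times in \<open>Q\<close>, and a neighbour of \<open>q\<close> with this colour would be nonadjacent to all these vertices.
  With \<open>d = 0\<close> and \<open>Q = {s}\<close> this is the familiar fact that no neighbourhood of a vertex of a critical
  graph is contained in that of a nonadjacent one.
\<close>
lemma undominated_vertex:
  assumes q: "q \<in> V" and Q: "Q \<subseteq> V - {q}" and big: "d * m < card Q"
  obtains w where "adj w q" "d < card {x \<in> Q. \<not> adj w x}"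
proof (rule ccontr)
  assume "\<not> thesis"
  then have few: "\<not> d < card {x \<in> Q. \<not> adj w x}" if "adj w q" for w
    using that \<open>\<And>w. adj w q \<Longrightarrow> d < card {x \<in> Q. \<not> adj w x} \<Longrightarrow> thesis\<close> by blast
  obtain c where c: "\<forall>v\<in>V - {q}. c v < m" "\<forall>u\<in>V - {q}. \<forall>v\<in>V - {q}. adj u v \<longrightarrow> c u \<noteq> c v"
    using critical[OF q] by blast
  have finQ: "finite Q" using Q finite_V by (meson finite_Diff finite_subset)
  obtain a where a: "a \<in> {..<m}" "d < card {x \<in> Q. c x = a}"
    by (rule popular_fibre[OF finQ, of "{..<m}" c d]) (use Q c big in auto)
  have avoid: "c w \<noteq> a" if "adj w q" for w
  proof
    assume "c w = a"
    have wV: "w \<in> V - {q}" using adj_V[OF that] that irrefl[of q] by auto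
    have "{x \<in> Q. c x = a} \<subseteq> {x \<in> Q. \<not> adj w x}"
    proof clarify
      fix x assume "x \<in> Q" "a = c x" "adj w x"
      moreover have "x \<in> V - {q}" using Q \<open>x \<in> Q\<close> by blast
      ultimately show False using c(2) wV \<open>c w = a\<close> by metis
    qed
    then have "d < card {x \<in> Q. \<not> adj w x}"
      using a(2) finQ by (intro less_le_trans[OF a(2) card_mono]) auto
    then show False using few that by blast
  qed
  have avoid': "c w \<noteq> a" if "adj q w" for w using avoid[OF adj_sym[OF that]] .
  have "\<exists>c. (\<forall>v\<in>V. c v < m) \<and> (\<forall>u\<in>V. \<forall>v\<in>V. adj u v \<longrightarrow> c u \<noteq> c v)"
  proof (intro exI conjI ballI impI)
    fix v assume "v \<in> V" then show "(c(q := a)) v < m" using c(1) a(1) by auto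
  next
    fix u v assume uv: "u \<in> V" "v \<in> V" "adj u v"
    show "(c(q := a)) u \<noteq> (c(q := a)) v"
    proof (cases "u = q \<or> v = q")
      case True
      then show ?thesis using avoid[of u] avoid'[of v] uv(3) irrefl[of q] by auto
    next
      case False
      then show ?thesis using c(2) uv by simp
    qed
  qed
  then show False using not_colourable by blast
qed

text \<open>
  By criticality some neighbour \<open>w\<close> of one \<open>q i0\<close> misses many other \<open>q j\<close>.  Such a \<open>w\<close> is adjacent to
  the corresponding \<open>v j\<close>, since otherwise \<open>w\<close>, \<open>q i0\<close>, \<open>v j\<close>, \<open>q i\<close> is an induced path and \<open>q j\<close> is
  isolated from it.  Among these \<open>v j\<close> there are two nonadjacent ones.  They have the common neighbours
  \<open>w\<close>, \<open>q i0\<close> and \<open>q i\<close>, of which only the first two are adjacent: a paraglider.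
\<close>
lemma co_matching_bounded:
  assumes fin: "finite I"
    and qV: "\<And>i. i \<in> I \<Longrightarrow> q i \<in> V"
    and indep: "\<And>i j. i \<in> I \<Longrightarrow> j \<in> I \<Longrightarrow> \<not> adj (q i) (q j)"
    and co: "\<And>i j. i \<in> I \<Longrightarrow> j \<in> I \<Longrightarrow> adj (v i) (q j) \<longleftrightarrow> i \<noteq> j"
  shows "card I \<le> Suc ((m + 2) * m)"
proof (rule ccontr)
  assume big: "\<not> ?thesis"
  then obtain i0 where o: "i0 \<in> I" by fastforce
  have inj: "inj_on q I"
  proof (rule inj_onI)
    fix i j assume "i \<in> I" "j \<in> I" "q i = q j"
    then show "i = j" using co[of i j] co[of i i] by auto
  qed
  let ?Q = "q ` (I - {i0})"
  have "card ?Q = card (I - {i0})" by (meson Diff_subset card_image inj inj_on_subset)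
  also have "\<dots> > (m + 2) * m" using big o fin by (simp add: card_Diff_singleton)
  finally have cQ: "(m + 2) * m < card ?Q" .
  have "?Q \<subseteq> V - {q i0}" using qV o inj by (auto simp: inj_on_eq_iff)
  then obtain w where w: "adj w (q i0)" "m + 2 < card {x \<in> ?Q. \<not> adj w x}"
    using undominated_vertex[OF qV[OF o] _ cQ] by blast
  define J where "J = {j \<in> I - {i0}. \<not> adj w (q j)}"
  have "{x \<in> ?Q. \<not> adj w x} = q ` J" by (auto simp: J_def)
  then have cJ: "m + 2 < card J"
    using w(2) card_image_le[of J q] fin by (auto simp: J_def)
  have JI: "j \<in> I" "j \<noteq> i0" "\<not> adj w (q j)" if "j \<in> J" for j using that by (auto simp: J_def)
  \<comment> \<open>The \<open>+ 2\<close> in the bound is for this step: an index beside two given ones.\<close>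
  have third: "\<exists>i\<in>J. i \<noteq> j \<and> i \<noteq> l" for j l
  proof (rule ccontr)
    assume "\<not> (\<exists>i\<in>J. i \<noteq> j \<and> i \<noteq> l)"
    then have "J \<subseteq> {j, l}" by blast
    then have "card J \<le> card {j, l}" by (intro card_mono) auto
    also have "\<dots> \<le> 2" by (simp add: card_insert_if)
    finally show False using cJ by simp
  qed
  have wv: "adj w (v j)" if j: "j \<in> J" for j
  proof (rule ccontr)
    assume no: "\<not> adj w (v j)"
    obtain i where i: "i \<in> J" "i \<noteq> j" using third[of j] by blast
    note J = JI[OF j] JI[OF i(1)]
    show False
    proof (rule co_gem_free)
      show "adj w (q i0)" by (rule w(1))
      show "adj (q i0) (v j)" using co[OF J(1) o] J(2) by (simp add: adj_commute)
      show "adj (v j) (q i)" using co[OF J(1,4)] i(2) by simp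
      show "\<not> adj (v j) (q j)" using co[OF J(1,1)] by simp
    qed (use no J qV o indep in simp_all)
  qed
  have injv: "inj_on v J"
  proof (rule inj_onI)
    fix i j assume "i \<in> J" "j \<in> J" "v i = v j"
    then show "i = j" using co[of i j] co[of j j] JI(1) by auto
  qed
  obtain j l where jl: "j \<in> J" "l \<in> J" "j \<noteq> l" "\<not> adj (v j) (v l)"
  proof (rule ccontr)
    assume "\<not> thesis"
    then have "\<forall>j\<in>J. \<forall>l\<in>J. j \<noteq> l \<longrightarrow> adj (v j) (v l)"
      using that by blast
    then have "card (v ` J) \<le> m"
    proof (intro clique_card_le)
      show "v ` J \<subseteq> V" using adj_V[OF adj_sym[OF wv]] by blast
    qed auto
    then show False using cJ injv by (simp add: card_image)
  qed
  obtain i where i: "i \<in> J" "i \<noteq> j" "i \<noteq> l" using third[of j l] by blast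
  show False
  proof (rule paraglider_free[of w "q i0" "v j" "v l" "q i"])
    show "adj (q i0) (v j)" "adj (q i0) (v l)" "adj (q i) (v j)" "adj (q i) (v l)"
      using co[OF JI(1) o, of j] co[OF JI(1) o, of l] co[OF JI(1)[OF jl(1)] JI(1)[OF i(1)]]
        co[OF JI(1)[OF jl(2)] JI(1)[OF i(1)]] JI(2)[OF jl(1)] JI(2)[OF jl(2)] jl i
      by (simp_all add: adj_commute)
    show "v j \<noteq> v l" using injv jl by (auto simp: inj_on_eq_iff)
    show "adj w (v j)" "adj w (v l)" by (rule wv[OF jl(1)], rule wv[OF jl(2)])
    show "\<not> adj w (q i)" by (rule JI(3)[OF i(1)])
    show "\<not> adj (q i0) (q i)" by (rule indep[OF o JI(1)[OF i(1)]])
  qed (rule w(1) jl(4))+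
qed

section \<open>Induced matchings from pairwise separation\<close>

text \<open>
  A descent consists of vertices \<open>w i\<close> with a common neighbour \<open>r\<close> and vertices \<open>q i\<close> such that \<open>w i\<close>
  misses \<open>q i\<close> and is adjacent to all \<open>q j\<close> with \<open>j < i\<close>.  Among many \<open>w i\<close> many are pairwise
  nonadjacent.  For these, the forbidden co-gem yields the adjacencies with \<open>i < j\<close> as well, so that
  they form a co-matching with the \<open>q i\<close>.
\<close>
lemma no_long_descent:
  assumes p: "descent_depth m \<le> p"
    and r: "\<And>i. i < p \<Longrightarrow> adj (w i) r \<and> \<not> adj r (q i)"
    and q: "\<And>i. i < p \<Longrightarrow> q i \<in> V \<and> \<not> adj (w i) (q i)"
    and indep: "\<And>i j. i < p \<Longrightarrow> j < p \<Longrightarrow> \<not> adj (q i) (q j)"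
    and later: "\<And>i j. i < p \<Longrightarrow> j < i \<Longrightarrow> adj (w i) (q j)"
  shows False
proof -
  have injw: "inj_on w {..<p}"
  proof (intro inj_onI)
    fix i j assume ij: "i \<in> {..<p}" "j \<in> {..<p}" "w i = w j"
    then show "i = j"
      by (metis later lessThan_iff linorder_neqE_nat q)
  qed
  have adj_sym': "adj (w i) (w j) \<Longrightarrow> adj (w j) (w i)" for i j by (rule adj_sym)
  have p': "ES 2 (Suc m) (m * m + 2 * m + 2) \<le> card {..<p}"
    using p by (simp add: descent_depth_def)
  show False
  proof (rule ramsey_relation[of "\<lambda>i j. adj (w i) (w j)", OF adj_sym' finite_lessThan p'])
    fix J assume J: "J \<subseteq> {..<p}" "card J = Suc m"
      "\<And>i j. i \<in> J \<Longrightarrow> j \<in> J \<Longrightarrow> i \<noteq> j \<Longrightarrow> adj (w i) (w j)"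
    have "card (w ` J) \<le> m"
    proof (rule clique_card_le)
      show "w ` J \<subseteq> V" using adj_V r J(1) by auto
    qed (use J(3) in auto)
    moreover have "card (w ` J) = card J" using injw J(1) by (meson card_image inj_on_subset)
    ultimately show False using J(2) by simp
  next
    fix J assume J: "J \<subseteq> {..<p}" "card J = m * m + 2 * m + 2"
      "\<And>i j. i \<in> J \<Longrightarrow> j \<in> J \<Longrightarrow> i \<noteq> j \<Longrightarrow> \<not> adj (w i) (w j)"
    have lt: "i < p" if "i \<in> J" for i using that J by auto
    have earlier: "adj (w i) (q j)" if ij: "i \<in> J" "j \<in> J" "i < j" for i j
    proof (rule ccontr)
      assume no: "\<not> adj (w i) (q j)"
      have ip: "i < p" and jp: "j < p" using ij lt by auto
      \<comment> \<open>The path is \<open>q i\<close>, \<open>w j\<close>, \<open>r\<close>, \<open>w i\<close>, and \<open>q j\<close> is isolated from it.\<close>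
      show False
      proof (rule co_gem_free)
        show "adj (q i) (w j)" by (rule adj_sym) (rule later[OF jp ij(3)])
        show "adj (w j) r" using r[OF jp] ..
        show "adj r (w i)" by (rule adj_sym) (use r[OF ip] in simp)
        show "q j \<in> V" using q[OF jp] ..
        show "\<not> adj (q i) r" using r[OF ip] by (simp add: adj_commute)
        show "\<not> adj (q i) (w i)" using q[OF ip] by (simp add: adj_commute)
        show "\<not> adj (w j) (w i)" using J(3)[OF ij(2,1)] ij(3) by simp
        show "\<not> adj (q i) (q j)" by (rule indep[OF ip jp])
        show "\<not> adj (w j) (q j)" using q[OF jp] ..
        show "\<not> adj r (q j)" using r[OF jp] ..
      qed (rule no)
    qed
    have "card J \<le> Suc ((m + 2) * m)"
    proof (rule co_matching_bounded)
      show "finite J" using J(1) finite_subset by blast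
      show "q i \<in> V" if "i \<in> J" for i using q[OF lt[OF that]] ..
      show "\<not> adj (q i) (q j)" if "i \<in> J" "j \<in> J" for i j
        by (rule indep[OF lt[OF that(1)] lt[OF that(2)]])
      show "adj (w i) (q j) \<longleftrightarrow> i \<noteq> j" if ij: "i \<in> J" "j \<in> J" for i j
      proof (cases i j rule: linorder_cases)
        case less
        then show ?thesis using earlier[OF ij] by simp
      next
        case equal
        then show ?thesis using q[OF lt[OF ij(1)]] by simp
      next
        case greater
        then show ?thesis using later[OF lt[OF ij(1)] greater] by simp
      qed
    qed
    then show False using J(2) by (simp add: algebra_simps)
  qed
qed

text \<open>
  The matching is given by the function that sends a vertex of \<open>T\<close> to its partner, because the
  partner of \<open>s\<close> is going to be added to the clique that \<open>s\<close> represents.  That \<open>T\<close> is independent is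
  known wherever this is used.
\<close>
definition induced_matching :: "'a set \<Rightarrow> 'a set \<Rightarrow> ('a \<Rightarrow> 'a) \<Rightarrow> bool" where
  "induced_matching A T w \<longleftrightarrow>
     (\<forall>s\<in>T. w s \<in> A \<and> (\<forall>t\<in>T. (adj (w s) t \<longleftrightarrow> s = t) \<and> \<not> adj (w s) (w t)))"

text \<open>
  If some vertex is adjacent to many but not all vertices of \<open>R\<close>, it is the last one of a descent
  whose other part lies in its neighbourhood.  Otherwise each vertex of \<open>R\<close> has a neighbour in \<open>A\<close>
  whose trace on \<open>R\<close> is small, and one with a maximal trace is chosen.  Small traces that meet are
  nested, as the absence of a co-gem leaves them only the alternative to cover \<open>R\<close>; hence the maximal
  ones are disjoint or equal.  Distinct ones belong to nonadjacent vertices for the same reason.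
\<close>
lemma matching_or_descent:
  assumes "R \<subseteq> V" "\<And>r s. r \<in> R \<Longrightarrow> s \<in> R \<Longrightarrow> \<not> adj r s"
    and "\<And>r s. r \<in> R \<Longrightarrow> s \<in> R \<Longrightarrow> r \<noteq> s \<Longrightarrow> \<exists>w\<in>A. adj w r \<and> \<not> adj w s"
    and "descent_bound n p \<le> card R"
  shows "(\<exists>T w. T \<subseteq> R \<and> card T = n \<and> induced_matching A T w) \<or>
    (\<exists>w q r. r \<in> R \<and> (\<forall>i<p. adj (w i) r \<and> q i \<in> R \<and> \<not> adj (w i) (q i) \<and> (\<forall>j<i. adj (w i) (q j))))"
  using assms
proof (induction p arbitrary: R)
  case 0
  then have "R \<noteq> {}" by auto
  then show ?case by auto
next
  case (Suc p)
  note RV = Suc.prems(1) and indep = Suc.prems(2) and sep = Suc.prems(3)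
  let ?M = "descent_bound n p"
  define N where "N w = {x \<in> R. adj w x}" for w
  have finR: "finite R" using RV finite_V finite_subset by blast
  have finN: "finite (N w)" for w using finR by (simp add: N_def)
  have big: "n * ?M + 2 * ?M + 1 \<le> card R" using Suc.prems(4) by simp
  show ?case
  proof (cases "\<exists>w. ?M \<le> card (N w) \<and> (\<exists>q\<in>R. \<not> adj w q)")
    case True
    then obtain w0 q0 where w0: "?M \<le> card (N w0)" "q0 \<in> R" "\<not> adj w0 q0" by blast
    have sub: "N w0 \<subseteq> R" by (auto simp: N_def)
    have adj0: "adj w0 x" if "x \<in> N w0" for x using that by (simp add: N_def)
    have "(\<exists>T w. T \<subseteq> N w0 \<and> card T = n \<and> induced_matching A T w) \<or>
      (\<exists>w q r. r \<in> N w0 \<and>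
        (\<forall>i<p. adj (w i) r \<and> q i \<in> N w0 \<and> \<not> adj (w i) (q i) \<and> (\<forall>j<i. adj (w i) (q j))))"
      (is "?A \<or> ?B")
    proof (rule Suc.IH)
      show "N w0 \<subseteq> V" using sub RV by (rule subset_trans)
    qed (use indep sep w0(1) sub in blast)+
    then show ?thesis
    proof
      assume ?A
      then obtain T w where "T \<subseteq> N w0" "card T = n" "induced_matching A T w" by blast
      then show ?thesis using subset_trans[OF _ sub] by (intro disjI1 exI conjI)
    next
      assume ?B
      then obtain w q r where B: "r \<in> N w0"
        "\<forall>i<p. adj (w i) r \<and> q i \<in> N w0 \<and> \<not> adj (w i) (q i) \<and> (\<forall>j<i. adj (w i) (q j))"
        by blast
      have "r \<in> R \<and> (\<forall>i<Suc p. adj ((w(p := w0)) i) r \<and> (q(p := q0)) i \<in> R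
        \<and> \<not> adj ((w(p := w0)) i) ((q(p := q0)) i)
        \<and> (\<forall>j<i. adj ((w(p := w0)) i) ((q(p := q0)) j)))"
        using B w0 sub adj0 by (auto simp: less_Suc_eq)
      then show ?thesis by blast
    qed
  next
    case False
    then have sparse: "card (N w) < ?M" if "q \<in> R" "\<not> adj w q" for w q
      using that by (meson not_le_imp_less)
    have "\<exists>w. (w \<in> A \<and> adj w r \<and> card (N w) < ?M) \<and>
        (\<forall>w'. w' \<in> A \<and> adj w' r \<and> card (N w') < ?M \<longrightarrow> card (N w') \<le> card (N w))"
      if r: "r \<in> R" for r
    proof -
      have "\<not> R \<subseteq> {r}"
        using big descent_bound_pos[of n p] card_mono[of "{r}" R] by fastforce
      then obtain s where "s \<in> R" "s \<noteq> r" by blast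
      then obtain w where "w \<in> A" "adj w r" "\<not> adj w s" using sep r by metis
      then have "w \<in> A \<and> adj w r \<and> card (N w) < ?M" using sparse \<open>s \<in> R\<close> by blast
      then show ?thesis
        by (rule ex_has_greatest_nat[where b = ?M]) auto
    qed
    then obtain w where w: "\<And>r. r \<in> R \<Longrightarrow> w r \<in> A \<and> adj (w r) r \<and> card (N (w r)) < ?M"
      and wmax: "\<And>r w'. r \<in> R \<Longrightarrow> w' \<in> A \<Longrightarrow> adj w' r \<Longrightarrow> card (N w') < ?M \<Longrightarrow>
        card (N w') \<le> card (N (w r))"
      by metis
    define X where "X r = N (w r)" for r
    have XR: "X r \<subseteq> R" for r by (auto simp: X_def N_def)
    have inX: "x \<in> X r \<longleftrightarrow> x \<in> R \<and> adj (w r) x" for x r by (simp add: X_def N_def)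
    have outside: "\<exists>z\<in>R. z \<notin> X r \<and> z \<notin> X s" if "r \<in> R" "s \<in> R" for r s
    proof (rule ccontr)
      assume "\<not> ?thesis"
      then have "R \<subseteq> X r \<union> X s" by blast
      then have "card R \<le> card (X r \<union> X s)" using finN by (intro card_mono) (auto simp: X_def)
      also have "\<dots> \<le> card (X r) + card (X s)" by (rule card_Un_le)
      also have "\<dots> < 2 * ?M" using w[OF that(1)] w[OF that(2)] by (simp add: X_def)
      finally show False using big by simp
    qed
    have nested: "X r = X s" if "r \<in> R" "s \<in> R" "X r \<subseteq> X s" for r s
    proof -
      have "r \<in> X s" using that w[OF that(1)] by (auto simp: inX)
      then have "card (X s) \<le> card (X r)"
        using wmax[OF that(1), of "w s"] w[OF that(2)] by (simp add: X_def N_def)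
      then show ?thesis using that(3) finN by (metis X_def card_seteq)
    qed
    have meet: "X r = X s" if r: "r \<in> R" and s: "s \<in> R" and a: "a \<in> X r" "a \<in> X s" for r s a
    proof (rule ccontr)
      assume ne: "X r \<noteq> X s"
      obtain b where b: "b \<in> X r" "b \<notin> X s" using nested[OF r s] ne by blast
      obtain b' where b': "b' \<in> X s" "b' \<notin> X r" using nested[OF s r] ne by blast
      obtain z where z: "z \<in> R" "z \<notin> X r" "z \<notin> X s" using outside[OF r s] by blast
      have R: "a \<in> R" "b \<in> R" "b' \<in> R" using a b b' XR by blast+
      have zV: "z \<in> V" using z RV by blast
      \<comment> \<open>The path is \<open>b\<close>, \<open>w r\<close>, \<open>w s\<close>, \<open>b'\<close> or else \<open>b\<close>, \<open>w r\<close>, \<open>a\<close>, \<open>w s\<close>.\<close>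
      show False
      proof (cases "adj (w r) (w s)")
        case True
        show False
          by (rule co_gem_free[of b "w r" "w s" b' z])
            (use True a b b' z R zV indep in \<open>simp_all add: inX adj_commute\<close>)
      next
        case False
        show False
          by (rule co_gem_free[of b "w r" a "w s" z])
            (use False a b b' z R zV indep in \<open>simp_all add: inX adj_commute\<close>)
      qed
    qed
    have self: "r \<in> X r" if "r \<in> R" for r using w[OF that] that by (simp add: inX)
    have "R \<subseteq> \<Union> (X ` R)" using self by blast
    then have "card R \<le> card (\<Union> (X ` R))" using finR finN by (intro card_mono) (auto simp: X_def)
    also have "\<dots> \<le> (\<Sum>Y\<in>X ` R. card Y)" by (rule card_Union_le_sum_card)
    also have "\<dots> \<le> card (X ` R) * ?M"
    proof -
      have "card Y \<le> ?M" if "Y \<in> X ` R" for Y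
        using that w by (auto simp: X_def dest: less_imp_le)
      then show ?thesis using sum_bounded_above[of "X ` R" card ?M] by simp
    qed
    finally have "n * ?M < card (X ` R) * ?M" using big by linarith
    then have "n \<le> card (X ` R)" by simp
    then obtain \<Y> where Y: "\<Y> \<subseteq> X ` R" "card \<Y> = n" by (meson obtain_subset_with_card_n)
    then obtain T where T: "T \<subseteq> R" "inj_on X T" "\<Y> = X ` T" by (meson subset_image_inj)
    have cT: "card T = n" using T Y by (simp add: card_image)
    have apart: "t \<notin> X s" if "s \<in> T" "t \<in> T" "s \<noteq> t" for s t
    proof
      assume t: "t \<in> X s"
      have R: "s \<in> R" "t \<in> R" using that T by auto
      have "X s = X t" using meet[OF R t self[OF R(2)]] .
      then show False using T(2) that by (auto simp: inj_on_eq_iff)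
    qed
    have nadj: "\<not> adj (w s) (w t)" if st: "s \<in> T" "t \<in> T" for s t
    proof (cases "s = t")
      case True
      then show ?thesis using irrefl by simp
    next
      case False
      have R: "s \<in> R" "t \<in> R" using that T by auto
      obtain z where z: "z \<in> R" "z \<notin> X s" "z \<notin> X t" using outside[OF R] by blast
      have zV: "z \<in> V" using z RV by blast
      show ?thesis
      proof
        assume "adj (w s) (w t)"
        then show False
          by (rule co_gem_free[of s "w s" "w t" t z, rotated])
            (use w[OF R(1)] w[OF R(2)] apart[OF st False] apart[OF st(2,1)] False z R zV indep
              in \<open>simp_all add: inX adj_commute\<close>)
      qed
    qed
    have "induced_matching A T w"
      unfolding induced_matching_def
      using w T(1) apart nadj by (auto simp: inX subset_iff)
    then show ?thesis using T(1) cT by blast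
  qed
qed

lemma induced_matching_exists:
  assumes "R \<subseteq> V" "\<And>r s. r \<in> R \<Longrightarrow> s \<in> R \<Longrightarrow> \<not> adj r s"
    and "\<And>r s. r \<in> R \<Longrightarrow> s \<in> R \<Longrightarrow> r \<noteq> s \<Longrightarrow> \<exists>w\<in>A. adj w r \<and> \<not> adj w s"
    and "descent_bound n (descent_depth m) \<le> card R"
  obtains T w where "T \<subseteq> R" "card T = n" "induced_matching A T w"
proof -
  let ?p = "descent_depth m"
  have "\<not> (r \<in> R \<and> (\<forall>i<?p. adj (w i) r \<and> q i \<in> R \<and> \<not> adj (w i) (q i) \<and> (\<forall>j<i. adj (w i) (q j))))"
    for w q r
  proof
    assume *: "r \<in> R \<and> (\<forall>i<?p. adj (w i) r \<and> q i \<in> R \<and> \<not> adj (w i) (q i) \<and> (\<forall>j<i. adj (w i) (q j)))"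
    show False
      by (rule no_long_descent[of ?p w r q]) (use * assms(1,2) in auto)
  qed
  then show thesis using matching_or_descent[OF assms] that by blast
qed

end

section \<open>Families of pairwise anticomplete cliques\<close>

context critical_graph begin

text \<open>
  Each clique is indexed by one of its own vertices.  Thus \<open>R\<close> is an independent set of the graph, and
  the results on independent sets apply to it without a choice of representatives.
\<close>
definition clique_family :: "nat \<Rightarrow> 'a set \<Rightarrow> ('a \<Rightarrow> 'a set) \<Rightarrow> bool" where
  "clique_family t R K \<longleftrightarrow>
     (\<forall>r\<in>R. r \<in> K r \<and> K r \<subseteq> V \<and> card (K r) = t \<and> (\<forall>x\<in>K r. \<forall>y\<in>K r. x \<noteq> y \<longrightarrow> adj x y)) \<and>
     (\<forall>r\<in>R. \<forall>s\<in>R. r \<noteq> s \<longrightarrow> (\<forall>x\<in>K r. \<forall>y\<in>K s. \<not> adj x y))"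

lemma clique_family_indep:
  assumes "clique_family t R K" "r \<in> R" "s \<in> R"
  shows "\<not> adj r s"
proof (cases "r = s")
  case True
  then show ?thesis by (simp add: irrefl)
next
  case False
  then show ?thesis using assms unfolding clique_family_def by blast
qed

lemma clique_family_extend_matching:
  assumes fam: "clique_family t R K" and T: "T \<subseteq> R" and w: "induced_matching A T w"
    and complete: "\<And>s x. s \<in> T \<Longrightarrow> x \<in> K s \<Longrightarrow> adj (w s) x"
    and apart: "\<And>s r x. s \<in> T \<Longrightarrow> r \<in> T \<Longrightarrow> s \<noteq> r \<Longrightarrow> x \<in> K r \<Longrightarrow> \<not> adj (w s) x"
  shows "clique_family (Suc t) T (\<lambda>s. insert (w s) (K s))"
  unfolding clique_family_def
proof (intro conjI ballI impI)
  fix r assume r: "r \<in> T"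
  then have rR: "r \<in> R" using T by blast
  have K: "r \<in> K r" "K r \<subseteq> V" "card (K r) = t" "\<And>x y. x \<in> K r \<Longrightarrow> y \<in> K r \<Longrightarrow> x \<noteq> y \<Longrightarrow> adj x y"
    using fam rR unfolding clique_family_def by blast+
  have "adj (w r) r" using complete[OF r K(1)] .
  then show "insert (w r) (K r) \<subseteq> V" using K(2) adj_V[of "w r" r] by blast
  show "r \<in> insert (w r) (K r)" using K(1) by simp
  have "w r \<notin> K r" using complete[OF r, of "w r"] irrefl by blast
  moreover have "finite (K r)" using K(2) finite_V finite_subset by blast
  ultimately show "card (insert (w r) (K r)) = Suc t" using K(3) by simp
  fix x y assume "x \<in> insert (w r) (K r)" "y \<in> insert (w r) (K r)" "x \<noteq> y"
  then show "adj x y" using K(4)[of x y] complete[OF r, of x] complete[OF r, of y] adj_sym by blast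
next
  fix r s x y assume rs: "r \<in> T" "s \<in> T" "r \<noteq> s"
    and x: "x \<in> insert (w r) (K r)" and y: "y \<in> insert (w s) (K s)"
  have K: "\<not> adj x y" if "x \<in> K r" "y \<in> K s"
    using fam T rs that unfolding clique_family_def by blast
  have W: "\<not> adj (w r) (w s)" using w rs unfolding induced_matching_def by blast
  show "\<not> adj x y"
    using x y K W apart[OF rs, of y] apart[OF rs(2,1), of x] rs(3) adj_commute[of x y] by auto
qed

end

text \<open>
  Cliques of size at least 2 are needed so that a vertex of a clique has a neighbour in it.  Four
  cliques leave two beside any two exceptional ones.
\<close>
locale anticomplete_cliques = critical_graph +
  fixes R :: "'a set" and K :: "'a \<Rightarrow> 'a set" and t :: nat
  assumes family: "clique_family t R K"
    and two: "2 \<le> t"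
    and four: "4 \<le> card R"
begin

lemma finite_R: "finite R"
  using four card.infinite by fastforce

lemma K_self: "r \<in> R \<Longrightarrow> r \<in> K r"
  using family unfolding clique_family_def by blast

lemma K_V: "r \<in> R \<Longrightarrow> x \<in> K r \<Longrightarrow> x \<in> V"
  using family unfolding clique_family_def by blast

lemma R_V: "r \<in> R \<Longrightarrow> r \<in> V"
  using K_self K_V by blast

lemma K_clique: "r \<in> R \<Longrightarrow> x \<in> K r \<Longrightarrow> y \<in> K r \<Longrightarrow> x \<noteq> y \<Longrightarrow> adj x y"
  using family unfolding clique_family_def by blast

lemma K_anti: "r \<in> R \<Longrightarrow> s \<in> R \<Longrightarrow> r \<noteq> s \<Longrightarrow> x \<in> K r \<Longrightarrow> y \<in> K s \<Longrightarrow> \<not> adj x y"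
  using family unfolding clique_family_def by blast

lemma K_other: 
  assumes "r \<in> R" "x \<in> K r"
  shows "\<exists>y\<in>K r. y \<noteq> x"
proof (rule ccontr)
  assume "\<not> ?thesis"
  then have "K r \<subseteq> {x}" by blast
  then have "card (K r) \<le> 1" using card_mono[of "{x}" "K r"] by simp
  then show False using family assms two unfolding clique_family_def by auto
qed

lemma avoid_three:
  obtains l where "l \<in> R" "l \<noteq> a" "l \<noteq> b" "l \<noteq> c"
proof (rule ccontr)
  assume "\<not> thesis"
  then have "R \<subseteq> {a, b, c}" using that by blast
  then have "card R \<le> card {a, b, c}" by (intro card_mono) auto
  also have "\<dots> \<le> 3" by (simp add: card_insert_if)
  finally show False using four by simp
qed

section \<open>How the other vertices see the cliques\<close>
definition touched :: "'a \<Rightarrow> 'a set" where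
  "touched v = {r \<in> R. \<exists>x\<in>K r. adj v x}"

definition shared :: "'a \<Rightarrow> bool" where
  "shared v \<longleftrightarrow> (\<exists>r\<in>touched v. \<exists>s\<in>touched v. r \<noteq> s)"

text \<open>
  The shared vertices with neighbours in every clique.  They need a separate treatment: without an
  untouched clique there is no isolated vertex that could complete a co-gem.
\<close>
definition hubs :: "'a set" where
  "hubs = {v. touched v = R}"

text \<open>
  The component of \<open>K r\<close> in the graph without the shared vertices.  By \<open>region_closed\<close> it has no
  vertices at a larger distance from \<open>K r\<close> than those given here.
\<close>
definition region :: "'a \<Rightarrow> 'a set" where
  "region r = {v. \<not> shared v \<and> (r \<in> touched v \<or> (\<exists>x. \<not> shared x \<and> r \<in> touched x \<and> adj x v))}"

lemma touchedE:
  assumes "r \<in> touched v"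
  obtains x where "r \<in> R" "x \<in> K r" "adj v x"
  using assms unfolding touched_def by blast

lemma untouched: "r \<in> R \<Longrightarrow> r \<notin> touched v \<Longrightarrow> x \<in> K r \<Longrightarrow> \<not> adj v x"
  unfolding touched_def by blast

lemma touched_R: "r \<in> touched v \<Longrightarrow> r \<in> R"
  unfolding touched_def by blast

lemma not_shared: "\<not> shared v \<Longrightarrow> r \<in> touched v \<Longrightarrow> s \<in> touched v \<Longrightarrow> r = s"
  unfolding shared_def by blast

lemma touched_K:
  assumes "r \<in> R" "x \<in> K r"
  shows "touched x = {r}"
proof -
  obtain y where "y \<in> K r" "y \<noteq> x" using K_other[OF assms] by blast
  then have "r \<in> touched x" unfolding touched_def using assms K_clique by blast
  moreover have "s = r" if "s \<in> touched x" for s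
    using that K_anti[OF assms(1)] assms(2) unfolding touched_def by blast
  ultimately show ?thesis by blast
qed

lemma K_not_shared: "r \<in> R \<Longrightarrow> x \<in> K r \<Longrightarrow> \<not> shared x"
  using touched_K unfolding shared_def by simp

lemma self_region: "r \<in> R \<Longrightarrow> r \<in> region r"
  using K_not_shared[of r r] touched_K[of r r] K_self[of r] unfolding region_def by simp

text \<open>
  An edge between them would be the middle edge of an induced path from \<open>K r\<close> to \<open>K s\<close>, and the
  representative of any third clique is isolated from that path.
\<close>
lemma touching_nonadjacent:
  assumes x: "\<not> shared x" "r \<in> touched x" and v: "\<not> shared v" "s \<in> touched v" and rs: "r \<noteq> s"
  shows "\<not> adj x v"
proof
  assume xv: "adj x v"
  obtain y where y: "r \<in> R" "y \<in> K r" "adj x y" using touchedE[OF x(2)] .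
  obtain z where z: "s \<in> R" "z \<in> K s" "adj v z" using touchedE[OF v(2)] .
  obtain l where l: "l \<in> R" "l \<noteq> r" "l \<noteq> s" using avoid_three .
  have nt: "r \<notin> touched v" "s \<notin> touched x" "l \<notin> touched x" "l \<notin> touched v"
    using not_shared x v rs l by blast+
  show False
  proof (rule co_gem_free)
    show "adj y x" by (rule adj_sym[OF y(3)])
    show "adj x v" by (rule xv)
    show "adj v z" by (rule z(3))
    show "l \<in> V" by (rule R_V[OF l(1)])
    show "\<not> adj y v" using untouched[OF y(1) nt(1) y(2)] adj_sym by blast
    show "\<not> adj y z" by (rule K_anti[OF y(1) z(1) rs y(2) z(2)])
    show "\<not> adj x z" by (rule untouched[OF z(1) nt(2) z(2)])
    show "\<not> adj y l" by (rule K_anti[OF y(1) l(1) l(2)[symmetric] y(2) K_self[OF l(1)]])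
    show "\<not> adj x l" by (rule untouched[OF l(1) nt(3) K_self[OF l(1)]])
    show "\<not> adj v l" by (rule untouched[OF l(1) nt(4) K_self[OF l(1)]])
    show "\<not> adj z l" by (rule K_anti[OF z(1) l(1) l(3)[symmetric] z(2) K_self[OF l(1)]])
  qed
qed

lemma region_touched:
  assumes "v \<in> region r" "s \<in> touched v"
  shows "s = r"
  using assms touching_nonadjacent not_shared unfolding region_def by blast

text \<open>
  If \<open>v\<close> has no neighbour in \<open>K r\<close>, there is an induced path from \<open>K r\<close> over some \<open>x\<close> to \<open>v\<close>.  A
  further vertex \<open>u\<close> outside of the region would extend it to an induced path on four vertices.
\<close>
lemma region_closed:
  assumes v: "v \<in> region r" and vu: "adj v u" and u: "\<not> shared u"
  shows "u \<in> region r"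
proof (cases "r \<in> touched v")
  case True
  then show ?thesis using v vu u unfolding region_def by blast
next
  case False
  then obtain x where x: "\<not> shared x" "r \<in> touched x" "adj x v" and nv: "\<not> shared v"
    using v unfolding region_def by blast
  obtain y where y: "r \<in> R" "y \<in> K r" "adj x y" using touchedE[OF x(2)] .
  show ?thesis
  proof (rule ccontr)
    assume nu: "u \<notin> region r"
    then have ru: "r \<notin> touched u" and xu: "\<not> adj x u" using u x unfolding region_def by blast+
    obtain l where l: "l \<in> R" "l \<noteq> r" "l \<notin> touched u"
    proof (cases "touched u = {}")
      case True
      then show thesis using avoid_three[of r r r] that by blast
    next
      case False
      then obtain s where "s \<in> touched u" by blast
      then show thesis using avoid_three[of r s s] that not_shared[OF u] by metis
    qed
    have nt: "l \<notin> touched v" "l \<notin> touched x"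
      using region_touched[OF v] l(2) not_shared[OF x(1) x(2)] by blast+
    show False
    proof (rule co_gem_free)
      show "adj y x" by (rule adj_sym[OF y(3)])
      show "adj x v" by (rule x(3))
      show "adj v u" by (rule vu)
      show "l \<in> V" by (rule R_V[OF l(1)])
      show "\<not> adj y v" using untouched[OF y(1) False y(2)] adj_sym by blast
      show "\<not> adj y u" using untouched[OF y(1) ru y(2)] adj_sym by blast
      show "\<not> adj x u" by (rule xu)
      show "\<not> adj y l" by (rule K_anti[OF y(1) l(1) l(2)[symmetric] y(2) K_self[OF l(1)]])
      show "\<not> adj x l" by (rule untouched[OF l(1) nt(2) K_self[OF l(1)]])
      show "\<not> adj v l" by (rule untouched[OF l(1) nt(1) K_self[OF l(1)]])
      show "\<not> adj u l" by (rule untouched[OF l(1) l(3) K_self[OF l(1)]])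
    qed
  qed
qed

text \<open>
  A vertex in two regions touches neither of the two cliques, and then it is the third vertex of an
  induced path on four vertices that begins in \<open>K r\<close>.
\<close>
lemma region_disjoint:
  assumes vr: "v \<in> region r" and vs: "v \<in> region s"
  shows "r = s"
proof (rule ccontr)
  assume rs: "r \<noteq> s"
  have nv: "\<not> shared v" using vr unfolding region_def by blast
  have "touched v = {}" using region_touched[OF vr] region_touched[OF vs] rs by blast
  then obtain x y where x: "\<not> shared x" "r \<in> touched x" "adj x v"
    and y: "\<not> shared y" "s \<in> touched y" "adj y v"
    using vr vs unfolding region_def by blast
  obtain z where z: "r \<in> R" "z \<in> K r" "adj x z" using touchedE[OF x(2)] .
  obtain l where l: "l \<in> R" "l \<noteq> r" "l \<noteq> s" using avoid_three .
  have nt: "s \<notin> touched x" "r \<notin> touched y" "l \<notin> touched x" "l \<notin> touched y"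
    using not_shared x(1,2) y(1,2) rs l by blast+
  show False
  proof (rule co_gem_free)
    show "adj z x" by (rule adj_sym[OF z(3)])
    show "adj x v" by (rule x(3))
    show "adj v y" by (rule adj_sym[OF y(3)])
    show "l \<in> V" by (rule R_V[OF l(1)])
    show "\<not> adj z v" using untouched[OF z(1) _ z(2), of v] \<open>touched v = {}\<close> adj_sym by blast
    show "\<not> adj z y" using untouched[OF z(1) nt(2) z(2)] adj_sym by blast
    show "\<not> adj x y" by (rule touching_nonadjacent[OF x(1,2) y(1,2) rs])
    show "\<not> adj z l" by (rule K_anti[OF z(1) l(1) l(2)[symmetric] z(2) K_self[OF l(1)]])
    show "\<not> adj x l" by (rule untouched[OF l(1) nt(3) K_self[OF l(1)]])
    show "\<not> adj v l" using untouched[OF l(1) _ K_self[OF l(1)], of v] \<open>touched v = {}\<close> by blast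
    show "\<not> adj y l" by (rule untouched[OF l(1) nt(4) K_self[OF l(1)]])
  qed
qed

text \<open>
  Here \<open>y\<close>, \<open>x\<close>, \<open>w\<close>, \<open>x'\<close> is an induced path and \<open>z\<close> is isolated from it.  So a vertex that is mixed
  on one clique and touches a second one is complete to all others.
\<close>
lemma mixed_and_missed:
  assumes r: "r \<in> R" "x \<in> K r" "y \<in> K r" "adj w x" "\<not> adj w y"
    and s: "s \<in> R" "x' \<in> K s" "adj w x'" and l: "l \<in> R" "z \<in> K l" "\<not> adj w z"
    and ne: "r \<noteq> s" "s \<noteq> l" "l \<noteq> r"
  shows False
proof (rule co_gem_free)
  have "x \<noteq> y" using r by blast
  then show "adj y x" using K_clique r by blast
  show "adj x w" by (rule adj_sym[OF r(4)])
  show "adj w x'" by (rule s(3))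
  show "z \<in> V" by (rule K_V[OF l(1,2)])
  show "\<not> adj y w" using r(5) adj_sym by blast
  show "\<not> adj y x'" by (rule K_anti[OF r(1) s(1) ne(1) r(3) s(2)])
  show "\<not> adj x x'" by (rule K_anti[OF r(1) s(1) ne(1) r(2) s(2)])
  show "\<not> adj y z" by (rule K_anti[OF r(1) l(1) ne(3)[symmetric] r(3) l(2)])
  show "\<not> adj x z" by (rule K_anti[OF r(1) l(1) ne(3)[symmetric] r(2) l(2)])
  show "\<not> adj x' z" by (rule K_anti[OF s(1) l(1) ne(2) s(2) l(2)])
qed (rule l(3))

lemma shared_complete:
  assumes w: "shared w" "w \<notin> hubs" and r: "r \<in> touched w" "y \<in> K r"
  shows "adj w y"
proof (rule ccontr)
  assume no: "\<not> adj w y"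
  obtain s where s: "s \<in> touched w" "s \<noteq> r" using w(1) r(1) unfolding shared_def by blast
  obtain x where x: "r \<in> R" "x \<in> K r" "adj w x" using touchedE[OF r(1)] .
  obtain x' where x': "s \<in> R" "x' \<in> K s" "adj w x'" using touchedE[OF s(1)] .
  obtain l where l: "l \<in> R" "l \<notin> touched w"
    using w(2) touched_R unfolding hubs_def by blast
  show False
    by (rule mixed_and_missed[OF x(1,2) r(2) x(3) no x' l(1) K_self[OF l(1)]
          untouched[OF l K_self[OF l(1)]]]) (use s r l in blast)+
qed

lemma hub_complete_except_one:
  assumes w: "w \<in> hubs" and r: "r \<in> R" "y \<in> K r" "\<not> adj w y" and s: "s \<in> R" "z \<in> K s" "\<not> adj w z"
  shows "r = s"
proof (rule ccontr)
  assume rs: "r \<noteq> s"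
  obtain l where l: "l \<in> R" "l \<noteq> r" "l \<noteq> s" using avoid_three .
  have t: "r \<in> touched w" "l \<in> touched w" using w r(1) l(1) unfolding hubs_def by blast+
  obtain x where x: "r \<in> R" "x \<in> K r" "adj w x" using touchedE[OF t(1)] .
  obtain x' where x': "l \<in> R" "x' \<in> K l" "adj w x'" using touchedE[OF t(2)] .
  show False
    by (rule mixed_and_missed[OF x(1,2) r(2) x(3) r(3) x' s]) (use l rs in blast)+
qed

text \<open>
  Two nonadjacent hubs are complete to a common clique \<open>K r\<close> and to a common clique \<open>K s\<close>.  An edge in
  \<open>K r\<close> and a vertex of \<open>K s\<close> then complete a paraglider.
\<close>
lemma hubs_clique:
  assumes w: "w \<in> hubs" and u: "u \<in> hubs" and ne: "w \<noteq> u"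
  shows "adj w u"
proof (rule ccontr)
  assume no: "\<not> adj w u"
  have ex: "\<exists>p. \<forall>r\<in>R. r \<noteq> p \<longrightarrow> (\<forall>y\<in>K r. adj v y)" if "v \<in> hubs" for v
    using hub_complete_except_one[OF that] by blast
  obtain p where p: "\<And>r y. r \<in> R \<Longrightarrow> r \<noteq> p \<Longrightarrow> y \<in> K r \<Longrightarrow> adj w y" using ex[OF w] by blast
  obtain q where q: "\<And>r y. r \<in> R \<Longrightarrow> r \<noteq> q \<Longrightarrow> y \<in> K r \<Longrightarrow> adj u y" using ex[OF u] by blast
  obtain r where r: "r \<in> R" "r \<noteq> p" "r \<noteq> q" using avoid_three .
  obtain s where s: "s \<in> R" "s \<noteq> p" "s \<noteq> q" "s \<noteq> r" using avoid_three .
  obtain e where e: "e \<in> K r" "e \<noteq> r" using K_other[OF r(1) K_self[OF r(1)]] by blast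
  note Kr = K_self[OF r(1)] and Ks = K_self[OF s(1)]
  show False
  proof (rule paraglider_free)
    show "adj r e" using K_clique[OF r(1) Kr e(1)] e(2) by blast
    show "adj r w" "adj e w" using p[OF r(1,2)] Kr e(1) adj_sym by blast+
    show "adj r u" "adj e u" using q[OF r(1,3)] Kr e(1) adj_sym by blast+
    show "adj s w" using p[OF s(1,2) Ks] adj_sym by blast
    show "adj s u" using q[OF s(1,3) Ks] adj_sym by blast
    show "\<not> adj r s" by (rule K_anti[OF r(1) s(1) s(4)[symmetric] Kr Ks])
    show "\<not> adj e s" by (rule K_anti[OF r(1) s(1) s(4)[symmetric] e(1) Ks])
  qed (rule ne no)+
qed

text \<open>
  The clique \<open>K l\<close> that \<open>w\<close> misses, beside \<open>K r\<close>, provides the isolated vertex of a co-gem.  The path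
  starts in the region, enters \<open>w\<close> from there, and leaves it into a clique that \<open>w\<close> touches.  It is
  used twice, for vertices next to \<open>K r\<close> and then for those at distance two.
\<close>
lemma shared_misses_region:
  assumes w: "shared w" and l: "l \<in> R" "l \<notin> touched w" "l \<noteq> r"
    and r: "r \<in> R" "r \<notin> touched w" and v: "v \<in> region r"
  shows "\<not> adj w v"
proof -
  obtain s where s: "s \<in> touched w" using w unfolding shared_def by blast
  obtain x' where x': "s \<in> R" "x' \<in> K s" "adj w x'" using touchedE[OF s] .
  have sr: "s \<noteq> r" "s \<noteq> l" using s r l by blast+
  note Kl = K_self[OF l(1)]
  have path: False if "adj y v" "adj v w" "\<not> adj y w" "y \<in> region r" "v \<in> region r" for y v
  proof -
    have nt: "s \<notin> touched y" "s \<notin> touched v" "l \<notin> touched y" "l \<notin> touched v"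
      using region_touched that(4,5) sr l(3) by blast+
    show False
    proof (rule co_gem_free)
      show "adj y v" "adj v w" "\<not> adj y w" by (rule that)+
      show "adj w x'" by (rule x'(3))
      show "l \<in> V" by (rule R_V[OF l(1)])
      show "\<not> adj y x'" "\<not> adj v x'" by (rule untouched[OF x'(1) _ x'(2)], rule nt)+
      show "\<not> adj y l" "\<not> adj v l" by (rule untouched[OF l(1) _ Kl], rule nt)+
      show "\<not> adj w l" by (rule untouched[OF l(1,2) Kl])
      show "\<not> adj x' l" by (rule K_anti[OF x'(1) l(1) sr(2) x'(2) Kl])
    qed
  qed
  have KD: "y \<in> region r" if "y \<in> K r" for y
    using that touched_K[OF r(1) that] K_not_shared[OF r(1) that] unfolding region_def by blast
  have touching: "\<not> adj w v" if vD: "v \<in> region r" and rv: "r \<in> touched v" for v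
  proof
    assume wv: "adj w v"
    obtain y where y: "y \<in> K r" "adj v y" using touchedE[OF rv] by metis
    have "\<not> adj y w" using untouched[OF r y(1)] adj_sym by blast
    then show False using path[OF adj_sym[OF y(2)] adj_sym[OF wv] _ KD[OF y(1)] vD] by blast
  qed
  show ?thesis
  proof (cases "r \<in> touched v")
    case True
    then show ?thesis using touching v by blast
  next
    case False
    then obtain x where x: "\<not> shared x" "r \<in> touched x" "adj x v"
      using v unfolding region_def by blast
    have xD: "x \<in> region r" using x unfolding region_def by blast
    have "\<not> adj x w" using touching[OF xD x(2)] adj_sym by blast
    then show ?thesis using path[OF x(3) adj_sym _ xD v] by blast
  qed
qed

text \<open>
  As in \<open>shared_misses_region\<close>, except that the path starts at a nonneighbour of \<open>w\<close> and reaches \<open>w\<close>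
  over a common neighbour.
\<close>
lemma shared_complete_region:
  assumes w: "shared w" "w \<notin> hubs" and r: "r \<in> touched w" and v: "v \<in> region r"
  shows "adj w v"
proof -
  obtain s where s: "s \<in> touched w" "s \<noteq> r" using w(1) r(1) unfolding shared_def by blast
  obtain x' where x': "s \<in> R" "x' \<in> K s" "adj w x'" using touchedE[OF s(1)] .
  obtain l where l: "l \<in> R" "l \<notin> touched w"
    using w(2) touched_R unfolding hubs_def by blast
  have lr: "l \<noteq> r" "s \<noteq> l" using l r s by blast+
  note Kl = K_self[OF l(1)]
  have rR: "r \<in> R" using touched_R r by blast
  have path: "adj w v" if "adj y v" "adj w y" "y \<in> region r" "v \<in> region r" for y v
  proof (rule ccontr)
    assume no: "\<not> adj w v"
    have nt: "s \<notin> touched y" "s \<notin> touched v" "l \<notin> touched y" "l \<notin> touched v"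
      using region_touched that(3,4) s(2) lr by blast+
    show False
    proof (rule co_gem_free)
      show "adj v y" by (rule adj_sym[OF that(1)])
      show "adj y w" by (rule adj_sym[OF that(2)])
      show "adj w x'" by (rule x'(3))
      show "l \<in> V" by (rule R_V[OF l(1)])
      show "\<not> adj v w" using no adj_sym by blast
      show "\<not> adj v x'" "\<not> adj y x'" by (rule untouched[OF x'(1) _ x'(2)], rule nt)+
      show "\<not> adj v l" "\<not> adj y l" by (rule untouched[OF l(1) _ Kl], rule nt)+
      show "\<not> adj w l" by (rule untouched[OF l(1,2) Kl])
      show "\<not> adj x' l" by (rule K_anti[OF x'(1) l(1) lr(2) x'(2) Kl])
    qed
  qed
  have touching: "adj w v" if vD: "v \<in> region r" and rv: "r \<in> touched v" for v
  proof -
    obtain y where y: "y \<in> K r" "adj v y" using touchedE[OF rv] by metis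
    have yD: "y \<in> region r"
      using touched_K[OF rR y(1)] K_not_shared[OF rR y(1)] unfolding region_def by blast
    show ?thesis by (rule path[OF adj_sym[OF y(2)] shared_complete[OF w r y(1)] yD vD])
  qed
  show ?thesis
  proof (cases "r \<in> touched v")
    case True
    then show ?thesis using touching v by blast
  next
    case False
    then obtain x where x: "\<not> shared x" "r \<in> touched x" "adj x v"
      using v unfolding region_def by blast
    have xD: "x \<in> region r" using x unfolding region_def by blast
    show ?thesis by (rule path[OF x(3) touching[OF xD x(2)] xD v])
  qed
qed

end

section \<open>Recolouring one region like another\<close>

text \<open>
  A bound for the number of sets of pairs \<open>(\<phi>, Y)\<close> with a colouring \<open>\<phi>\<close> of at most \<open>m\<close> hubs and a
  set \<open>Y\<close> of colours.
\<close>

definition pattern_bound :: "nat \<Rightarrow> nat" where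
  "pattern_bound m = 2 ^ (Suc m ^ m * 2 ^ m)"

text \<open>
  The summands pay for the pigeonhole argument over the types of regions, for the avoidable cliques, and for
  the four cliques that the analysis of the regions requires.
\<close>
definition step_bound :: "nat \<Rightarrow> nat \<Rightarrow> nat" where
  "step_bound m n =
     pattern_bound m * descent_bound n (descent_depth m) + Suc ((m + 2) * m) + 4"

context anticomplete_cliques begin

text \<open>
  For such \<open>r\<close> the lemma \<open>shared_misses_region\<close> says nothing about \<open>w\<close>, so these cliques are discarded.
\<close>
definition avoidable :: "'a \<Rightarrow> bool" where
  "avoidable r \<longleftrightarrow> (\<exists>w. touched w = R - {r})"

text \<open>
  The set of all \<open>(\<phi>, Y)\<close> that satisfy this is the type of the region: it records all that matters when
  the region is coloured with colours from \<open>Y\<close> after the hubs have been coloured by \<open>\<phi>\<close>.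
\<close>
definition extendable :: "'a \<Rightarrow> ('a \<Rightarrow> nat) \<Rightarrow> nat set \<Rightarrow> bool" where
  "extendable r \<phi> Y \<longleftrightarrow>
     (\<exists>c. \<forall>v\<in>region r. c v \<in> Y \<and> (\<forall>u\<in>region r. adj u v \<longrightarrow> c u \<noteq> c v) \<and> (\<forall>w\<in>hubs. adj w v \<longrightarrow> c v \<noteq> \<phi> w))"

lemma shared_alternative:
  assumes "r \<in> R" "touched w = R - {r}"
  shows "shared w" "w \<notin> hubs"
proof -
  obtain s where s: "s \<in> R" "s \<noteq> r" using avoid_three[of r r r] by blast
  obtain l where l: "l \<in> R" "l \<noteq> r" "l \<noteq> s" using avoid_three[of r s s] by blast
  show "shared w" unfolding shared_def assms(2) using s l by blast
  show "w \<notin> hubs" unfolding hubs_def using assms by blast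
qed

lemma adj_iff_touched:
  assumes "shared w" "w \<notin> hubs" "r \<in> R"
  shows "adj w r \<longleftrightarrow> r \<in> touched w"
  using shared_complete[OF assms(1,2) _ K_self[OF assms(3)]] untouched[OF assms(3) _ K_self[OF assms(3)]]
  by blast

lemma R_indep: "r \<in> R \<Longrightarrow> s \<in> R \<Longrightarrow> \<not> adj r s"
  by (rule clique_family_indep[OF family])

text \<open>
  The witnesses form a co-matching with the representatives.
\<close>
lemma few_avoidable: "card {r \<in> R. avoidable r} \<le> Suc ((m + 2) * m)"
proof -
  define w where "w r = (SOME v. touched v = R - {r})" for r
  have w: "touched (w r) = R - {r}" if "avoidable r" for r
    using that unfolding avoidable_def w_def by (rule someI_ex)
  show ?thesis
  proof (rule co_matching_bounded)
    show "finite {r \<in> R. avoidable r}" using finite_R by simp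
    fix r s assume r: "r \<in> {r \<in> R. avoidable r}" and s: "s \<in> {r \<in> R. avoidable r}"
    have t: "touched (w r) = R - {r}" using w r by blast
    have "shared (w r)" "w r \<notin> hubs" using shared_alternative[OF _ t] r by blast+
    then show "adj (w r) s \<longleftrightarrow> r \<noteq> s" using adj_iff_touched[of "w r" s] s t by auto
  qed (use R_V R_indep in auto)
qed

text \<open>
  Suppose that every shared vertex that is not a hub and touches \<open>K r\<close> touches \<open>K s\<close> as well.  Take an
  \<open>m\<close>-colouring \<open>c\<close> of the graph without \<open>r\<close>, and recolour the region of \<open>r\<close> within the colours that
  \<open>c\<close> uses on the region of \<open>s\<close>, in a way that is compatible with the hubs.  A shared vertex with a
  neighbour in the region of \<open>r\<close> is complete to the region of \<open>s\<close>, hence it avoids these colours, and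
  the result is an \<open>m\<close>-colouring of the whole graph.
\<close>
lemma recolouring_separates:
  assumes r: "r \<in> R" "\<not> avoidable r" and s: "s \<in> R" "r \<noteq> s"
    and same: "\<And>\<phi> Y. \<phi> \<in> hubs \<rightarrow>\<^sub>E {..<m} \<Longrightarrow> Y \<subseteq> {..<m} \<Longrightarrow> extendable s \<phi> Y \<Longrightarrow> extendable r \<phi> Y"
  shows "\<exists>w. shared w \<and> w \<notin> hubs \<and> r \<in> touched w \<and> s \<notin> touched w"
proof (rule ccontr)
  assume "\<not> ?thesis"
  then have none: "s \<in> touched w" if "shared w" "w \<notin> hubs" "r \<in> touched w" for w
    using that by blast
  obtain c where c: "\<forall>v\<in>V - {r}. c v < m" "\<forall>u\<in>V - {r}. \<forall>v\<in>V - {r}. adj u v \<longrightarrow> c u \<noteq> c v"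
    using critical[OF R_V[OF r(1)]] by blast
  have touched_V: "v \<in> V" if t: "p \<in> touched v" for v p
  proof -
    obtain x where "adj v x" using touchedE[OF t] by metis
    then show ?thesis by (rule adj_V)
  qed
  have DV: "v \<in> V" if v: "v \<in> region p" for v p
  proof (cases "p \<in> touched v")
    case True
    then show ?thesis by (rule touched_V)
  next
    case False
    then obtain x where "adj x v" using v unfolding region_def by blast
    then show ?thesis by (rule adj_V[OF adj_sym])
  qed
  have region_not_shared: "\<not> shared v" if "v \<in> region p" for v p using that unfolding region_def by blast
  have hub_shared: "shared w" if "w \<in> hubs" for w
  proof -
    have "touched w = R" using that by (simp add: hubs_def)
    then show ?thesis using r(1) s unfolding shared_def by blast
  qed
  have hub_V: "w \<in> V - {r}" if w: "w \<in> hubs" for w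
  proof -
    have "r \<in> touched w" using w r(1) by (simp add: hubs_def)
    then have "w \<in> V" by (rule touched_V)
    moreover have "w \<noteq> r" using hub_shared[OF w] region_not_shared[OF self_region[OF r(1)]] by blast
    ultimately show ?thesis by blast
  qed
  have Ds: "v \<in> V - {r}" if "v \<in> region s" for v
    using DV[OF that] region_disjoint[OF that] self_region[OF r(1)] s(2) by blast
  have "extendable s (restrict c hubs) (c ` region s)"
    unfolding extendable_def
  proof (intro exI[of _ c] ballI conjI impI)
    fix v u assume "v \<in> region s" "u \<in> region s" "adj u v"
    then show "c u \<noteq> c v" using c(2) Ds by blast
  next
    fix v w assume "v \<in> region s" "w \<in> hubs" "adj w v"
    then have "c w \<noteq> c v" using c(2) Ds hub_V by blast
    then show "c v \<noteq> restrict c hubs w" using \<open>w \<in> hubs\<close> by simp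
  qed simp
  moreover have "restrict c hubs \<in> hubs \<rightarrow>\<^sub>E {..<m}" using c(1) hub_V by auto
  moreover have "c ` region s \<subseteq> {..<m}" using c(1) Ds by auto
  ultimately have "extendable r (restrict c hubs) (c ` region s)" using same by blast
  then obtain c' where c': "\<And>v. v \<in> region r \<Longrightarrow> c' v \<in> c ` region s"
    "\<And>u v. u \<in> region r \<Longrightarrow> v \<in> region r \<Longrightarrow> adj u v \<Longrightarrow> c' u \<noteq> c' v"
    "\<And>v w. v \<in> region r \<Longrightarrow> w \<in> hubs \<Longrightarrow> adj w v \<Longrightarrow> c' v \<noteq> restrict c hubs w"
    unfolding extendable_def by blast
  have Dr: "v \<in> V - {r}" if "v \<in> V" "v \<notin> region r" for v using that self_region[OF r(1)] by blast
  have crossing: "c' v \<noteq> c u" if v: "v \<in> region r" and u: "u \<notin> region r" and uv: "adj u v" for u v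
  proof (cases "u \<in> hubs")
    case True
    then show ?thesis using c'(3)[OF v True uv] by simp
  next
    case False
    have su: "shared u" using region_closed[OF v adj_sym[OF uv]] u by blast
    have ru: "r \<in> touched u"
    proof (rule ccontr)
      assume nru: "r \<notin> touched u"
      have "touched u \<noteq> R - {r}" using r(2) unfolding avoidable_def by blast
      then obtain l where "l \<in> R" "l \<notin> touched u" "l \<noteq> r" using nru touched_R by blast
      then show False using shared_misses_region[OF su _ _ _ r(1) nru v] uv by blast
    qed
    have st: "s \<in> touched u" by (rule none[OF su False ru])
    have uV: "u \<in> V - {r}" using Dr[OF adj_V[OF uv] u] .
    obtain x where x: "x \<in> region s" "c' v = c x" using c'(1)[OF v] by blast
    have "adj u x" by (rule shared_complete_region[OF su False st x(1)])
    then show ?thesis using c(2) uV Ds[OF x(1)] x(2) by metis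
  qed
  define e where "e v = (if v \<in> region r then c' v else c v)" for v
  have "\<exists>c. (\<forall>v\<in>V. c v < m) \<and> (\<forall>u\<in>V. \<forall>v\<in>V. adj u v \<longrightarrow> c u \<noteq> c v)"
  proof (intro exI[of _ e] conjI ballI impI)
    fix v assume v: "v \<in> V"
    show "e v < m"
    proof (cases "v \<in> region r")
      case True
      then obtain x where "x \<in> region s" "c' v = c x" using c'(1) by blast
      then show ?thesis using True c(1) Ds by (auto simp: e_def)
    next
      case False
      then show ?thesis using c(1) Dr[OF v] by (simp add: e_def)
    qed
  next
    fix u v assume uv: "u \<in> V" "v \<in> V" "adj u v"
    consider "u \<in> region r" "v \<in> region r" | "u \<in> region r" "v \<notin> region r"
      | "u \<notin> region r" "v \<in> region r" | "u \<notin> region r" "v \<notin> region r"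
      by blast
    then show "e u \<noteq> e v"
    proof cases
      case 1
      then show ?thesis using c'(2)[OF 1 uv(3)] by (simp add: e_def)
    next
      case 2
      then show ?thesis using crossing[OF 2 adj_sym[OF uv(3)]] by (simp add: e_def)
    next
      case 3
      then show ?thesis using crossing[OF 3(2,1) uv(3)] by (simp add: e_def)
    next
      case 4
      then show ?thesis using c(2) Dr uv by (simp add: e_def)
    qed
  qed
  then show False using not_colourable by blast
qed

text \<open>
  After the avoidable cliques have been discarded, many of the regions left have the same type, and
  any two of these are separated.  The induced matching between the shared vertices and the
  representatives of these cliques extends to the whole cliques, because a shared vertex that is not a
  hub is complete to every clique that it touches.
\<close>
lemma extend_family:
  assumes big: "step_bound m n \<le> card R"
  obtains T K' where "clique_family (Suc t) T K'" "T \<subseteq> R" "card T = n"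
proof -
  have hubs_V: "hubs \<subseteq> V"
  proof
    fix w assume "w \<in> hubs"
    obtain r where "r \<in> R" using four by fastforce
    then have t: "r \<in> touched w" using \<open>w \<in> hubs\<close> by (simp add: hubs_def)
    obtain x where "adj w x" using touchedE[OF t] by metis
    then show "w \<in> V" by (rule adj_V)
  qed
  have card_hubs: "card hubs \<le> m" using clique_card_le[OF hubs_V] hubs_clique by blast
  have finite_hubs: "finite hubs" using hubs_V finite_V finite_subset by blast
  define U where "U = (hubs \<rightarrow>\<^sub>E {..<m}) \<times> Pow {..<m}"
  define P where "P r = {(\<phi>, Y). (\<phi>, Y) \<in> U \<and> extendable r \<phi> Y}" for r
  let ?d = "descent_bound n (descent_depth m)"
  let ?X = "{r \<in> R. \<not> avoidable r}"
  have finU: "finite U"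
    unfolding U_def using finite_hubs by (intro finite_cartesian_product finite_PiE) auto
  have "card U = m ^ card hubs * 2 ^ m"
    unfolding U_def using finite_hubs by (simp add: card_cartesian_product card_PiE card_Pow)
  also have "\<dots> \<le> Suc m ^ m * 2 ^ m"
  proof -
    have "m ^ card hubs \<le> Suc m ^ card hubs" by (rule power_mono) auto
    also have "\<dots> \<le> Suc m ^ m" using card_hubs by (intro power_increasing) auto
    finally show ?thesis by simp
  qed
  finally have cU: "card (Pow U) \<le> pattern_bound m"
    using finU unfolding pattern_bound_def by (simp add: card_Pow)
  have "card R = card (?X \<union> {r \<in> R. avoidable r})" by (rule arg_cong[of _ _ card]) blast
  also have "\<dots> \<le> card ?X + card {r \<in> R. avoidable r}" by (rule card_Un_le)
  also have "\<dots> \<le> card ?X + Suc ((m + 2) * m)" using few_avoidable by simp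
  finally have "pattern_bound m * ?d + 4 \<le> card ?X" using big unfolding step_bound_def by simp
  moreover have "?d * card (Pow U) \<le> pattern_bound m * ?d"
    using mult_le_mono1[OF cU] by (simp add: mult.commute)
  ultimately have large: "?d * card (Pow U) < card ?X" by linarith
  have "P ` ?X \<subseteq> Pow U" by (auto simp: P_def)
  then obtain p where p: "?d < card {r \<in> ?X. P r = p}"
    by (rule popular_fibre[of ?X "Pow U" P ?d, rotated 2, OF _ large]) (use finU finite_R in auto)
  define S where "S = {r \<in> ?X. P r = p}"
  define A where "A = {w. shared w \<and> w \<notin> hubs}"
  have SR: "S \<subseteq> R" by (auto simp: S_def)
  have sep: "\<exists>w\<in>A. adj w r \<and> \<not> adj w s" if rs: "r \<in> S" "s \<in> S" "r \<noteq> s" for r s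
  proof -
    have R: "r \<in> R" "s \<in> R" "\<not> avoidable r" "P r = P s" using rs by (auto simp: S_def)
    have "extendable r \<phi> Y" if "\<phi> \<in> hubs \<rightarrow>\<^sub>E {..<m}" "Y \<subseteq> {..<m}" "extendable s \<phi> Y" for \<phi> Y
    proof -
      have "(\<phi>, Y) \<in> P s" using that by (simp add: P_def U_def)
      then show ?thesis using R(4) by (auto simp: P_def)
    qed
    then obtain w where w: "shared w" "w \<notin> hubs" "r \<in> touched w" "s \<notin> touched w"
      using recolouring_separates[OF R(1,3,2) rs(3)] by blast
    then show ?thesis using adj_iff_touched[OF w(1,2)] R by (auto simp: A_def)
  qed
  obtain T w where T: "T \<subseteq> S" "card T = n" "induced_matching A T w"
  proof (rule induced_matching_exists[of S A n])
    show "S \<subseteq> V" using SR R_V by blast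
    show "\<not> adj r s" if "r \<in> S" "s \<in> S" for r s using that SR R_indep by blast
    show "?d \<le> card S" using p by (simp add: S_def)
  qed (rule sep)
  have TR: "T \<subseteq> R" using T SR by blast
  have wT: "shared (w s)" "w s \<notin> hubs" "s \<in> touched (w s)" "\<And>r. r \<in> T \<Longrightarrow> r \<noteq> s \<Longrightarrow> r \<notin> touched (w s)"
    if s: "s \<in> T" for s
  proof -
    have *: "w s \<in> A" "\<And>r. r \<in> T \<Longrightarrow> adj (w s) r \<longleftrightarrow> s = r"
      using T(3) s unfolding induced_matching_def by blast+
    show sh: "shared (w s)" and nF: "w s \<notin> hubs" using *(1) by (auto simp: A_def)
    show "s \<in> touched (w s)" using *(2)[OF s] adj_iff_touched[OF sh nF, of s] s TR by blast
    show "r \<notin> touched (w s)" if "r \<in> T" "r \<noteq> s" for r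
      using *(2)[OF that(1)] adj_iff_touched[OF sh nF, of r] that TR by blast
  qed
  have "clique_family (Suc t) T (\<lambda>s. insert (w s) (K s))"
  proof (rule clique_family_extend_matching[OF family TR T(3)])
    show "adj (w s) x" if "s \<in> T" "x \<in> K s" for s x
      by (rule shared_complete[OF wT(1-3)[OF that(1)] that(2)])
    show "\<not> adj (w s) x" if st: "s \<in> T" "r \<in> T" "s \<noteq> r" "x \<in> K r" for s r x
      using untouched[OF _ wT(4)[OF st(1,2)] st(4)] st TR by blast
  qed
  then show thesis using that TR T(2) by blast
qed

end

section \<open>The order of a critical graph is bounded\<close>

context critical_graph begin

lemma clique_family_step:
  assumes fam: "clique_family t R K" and t: "1 \<le> t" and big: "step_bound m n \<le> card R"
  obtains T K' where "clique_family (Suc t) T K'" "card T = n"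
proof (cases "t = 1")
  case False
  interpret anticomplete_cliques V adj m R K t
    by unfold_locales (use fam t False big in \<open>auto simp: step_bound_def\<close>)
  show thesis using extend_family[OF big] that by blast
next
  case True
  have RV: "R \<subseteq> V" using fam unfolding clique_family_def by blast
  have K: "K r = {r}" if "r \<in> R" for r
  proof -
    have "r \<in> K r" "card (K r) = 1" using fam that True unfolding clique_family_def by blast+
    then show ?thesis by (metis card_1_singletonE singletonD)
  qed
  note indep = clique_family_indep[OF fam]
  have "0 < pattern_bound m" by (simp add: pattern_bound_def)
  then have "descent_bound n (descent_depth m) \<le> pattern_bound m * descent_bound n (descent_depth m)"
    by (cases "pattern_bound m") auto
  then have d: "descent_bound n (descent_depth m) \<le> card R"
    using big unfolding step_bound_def by linarith
  have sep: "\<exists>w\<in>UNIV. adj w r \<and> \<not> adj w s" if rs: "r \<in> R" "s \<in> R" "r \<noteq> s" for r s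
  proof -
    obtain w where w: "adj w r" "0 < card {x \<in> {s}. \<not> adj w x}"
      by (rule undominated_vertex[of r "{s}" 0]) (use rs RV in auto)
    then have "{x \<in> {s}. \<not> adj w x} \<noteq> {}" by (metis card.empty less_numeral_extra(3))
    then show ?thesis using w(1) by blast
  qed
  obtain T w where T: "T \<subseteq> R" "card T = n" "induced_matching UNIV T w"
    by (rule induced_matching_exists[OF RV indep sep d])
  have adjw: "adj (w s) r \<longleftrightarrow> s = r" if "s \<in> T" "r \<in> T" for s r
    using T(3) that unfolding induced_matching_def by blast
  have "clique_family (Suc t) T (\<lambda>s. insert (w s) (K s))"
  proof (rule clique_family_extend_matching[OF fam T(1,3)])
    show "adj (w s) x" if "s \<in> T" "x \<in> K s" for s x
      using that K[of s] T(1) adjw[of s s] by auto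
    show "\<not> adj (w s) x" if "s \<in> T" "r \<in> T" "s \<noteq> r" "x \<in> K r" for s r x
      using that K[of r] T(1) adjw[of s r] by auto
  qed
  then show thesis using that T(2) by blast
qed

text \<open>
  Each step makes the cliques larger by one vertex, and there is no clique on \<open>m + 1\<close> vertices.
\<close>
lemma clique_family_bounded:
  assumes "clique_family t R K" "1 \<le> t" "m < t + j" "(step_bound m ^^ j) 1 \<le> card R"
  shows False
  using assms
proof (induction j arbitrary: t R K)
  case 0
  then obtain r where r: "r \<in> R" by fastforce
  have "card (K r) \<le> m"
    using 0(1) r unfolding clique_family_def by (intro clique_card_le) blast+
  moreover have "card (K r) = t" using 0(1) r unfolding clique_family_def by blast
  ultimately show False using 0(3) by simp
next
  case (Suc j)
  obtain T K' where T: "clique_family (Suc t) T K'" "card T = (step_bound m ^^ j) 1"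
    using clique_family_step[OF Suc.prems(1,2)] Suc.prems(4) by (metis comp_apply funpow.simps(2))
  show False by (rule Suc.IH[OF T(1)]) (use Suc.prems T(2) in auto)
qed

lemma card_V_less: "card V < ES 2 (Suc m) ((step_bound m ^^ m) 1)"
proof (rule ccontr)
  assume "\<not> ?thesis"
  then have big: "ES 2 (Suc m) ((step_bound m ^^ m) 1) \<le> card V" by simp
  show False
  proof (rule ramsey_relation[of adj, OF adj_sym finite_V big])
    fix J assume J: "J \<subseteq> V" "card J = Suc m" "\<And>i j. i \<in> J \<Longrightarrow> j \<in> J \<Longrightarrow> i \<noteq> j \<Longrightarrow> adj i j"
    then show False using clique_card_le[OF J(1,3)] by simp
  next
    fix J assume J: "J \<subseteq> V" "card J = (step_bound m ^^ m) 1"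
      "\<And>i j. i \<in> J \<Longrightarrow> j \<in> J \<Longrightarrow> i \<noteq> j \<Longrightarrow> \<not> adj i j"
    have "clique_family 1 J (\<lambda>r. {r})"
      unfolding clique_family_def using J by auto
    then show False by (rule clique_family_bounded[where j = m]) (use J in auto)
  qed
qed

end

section \<open>Translation to digraphs\<close>

lemma digraph_iso_map:
  fixes G :: "'a pair_pre_digraph" and f :: "'a \<Rightarrow> 'b"
  assumes G: "pair_wf_digraph G" and inj: "inj_on f (pverts G)"
  shows "digraph_iso (with_proj G)
    (with_proj \<lparr>pverts = f ` pverts G, parcs = map_prod f f ` parcs G\<rparr>)"
proof -
  interpret pair_wf_digraph G by fact
  define h where "h = \<lparr>iso_verts = f, iso_arcs = map_prod f f, iso_head = snd, iso_tail = fst\<rparr>"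
  have sub: "parcs G \<subseteq> pverts G \<times> pverts G"
    using arc_fst_in_verts arc_snd_in_verts by force
  have "inj_on (map_prod f f) (parcs G)"
    using map_prod_inj_on[OF inj inj] sub by (rule inj_on_subset)
  then have "pre_digraph.digraph_isomorphism (with_proj G) h"
    unfolding pre_digraph.digraph_isomorphism_def h_def using inj wf_digraph_axioms by auto
  then show ?thesis
    unfolding digraph_iso_def
    by (intro exI[of _ h]) (simp add: app_iso_def h_def with_proj_def)
qed

lemma induced_copy:
  fixes G :: "'a pair_pre_digraph" and H :: "'b pair_pre_digraph"
  assumes G: "pair_wf_digraph G" and H: "pair_wf_digraph H"
    and inj: "inj_on f (pverts H)" and sub: "f ` pverts H \<subseteq> pverts G"
    and arcs: "\<And>u v. u \<in> pverts H \<Longrightarrow> v \<in> pverts H \<Longrightarrow> (f u, f v) \<in> parcs G \<longleftrightarrow> (u, v) \<in> parcs H"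
  shows "\<not> induced_free (with_proj H) (with_proj G)"
proof -
  interpret H: pair_wf_digraph H by fact
  define K where "K = \<lparr>pverts = f ` pverts H, parcs = map_prod f f ` parcs H\<rparr>"
  have ends: "u \<in> pverts H" "v \<in> pverts H" if "(u, v) \<in> parcs H" for u v
    using H.arc_fst_in_verts[OF that] H.arc_snd_in_verts[OF that] by auto
  have K: "pair_wf_digraph K" by unfold_locales (use ends in \<open>auto simp: K_def\<close>)
  have "parcs K = {e \<in> parcs G. fst e \<in> f ` pverts H \<and> snd e \<in> f ` pverts H}"
    using ends arcs by (force simp: K_def)
  then have "induced_subgraph (with_proj K) (with_proj G)"
    unfolding induced_subgraph_def subgraph_def compatible_def wf_digraph_wp_iff
    using sub G K by (auto simp: K_def)
  moreover have "digraph_iso (with_proj K) (with_proj H)"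
    using digraph_iso_swap[OF _ digraph_iso_map[OF H inj]] H by (simp add: K_def wf_digraph_wp_iff)
  ultimately show ?thesis unfolding induced_free_def by blast
qed

lemma chromatic_number_le:
  "proper_colouring G n c \<Longrightarrow> chromatic_number G \<le> n"
  unfolding chromatic_number_def by (blast intro: Least_le)

lemma proper_colouring_mono:
  "proper_colouring G n c \<Longrightarrow> n \<le> n' \<Longrightarrow> proper_colouring G n' c"
  unfolding proper_colouring_def by fastforce

lemma critical_graph_of_vertex_critical:
  fixes G :: "'a pair_pre_digraph"
  assumes k: "1 \<le> k" and G: "pair_graph G" and crit: "vertex_critical k (with_proj G)"
    and cg: "induced_free (with_proj co_gem) (with_proj G)"
    and pg: "induced_free (with_proj paraglider) (with_proj G)"
    and large: "k < card (pverts G)"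
  shows "critical_graph (pverts G) (\<lambda>u v. (u, v) \<in> parcs G) (k - 1)"
proof -
  interpret pair_graph G by fact
  have wfG: "pair_wf_digraph G" by unfold_locales
  have ends: "u \<in> pverts G" "v \<in> pverts G" if "(u, v) \<in> parcs G" for u v
    using arc_fst_in_verts[OF that] arc_snd_in_verts[OF that] by auto
  have sym: "(v, u) \<in> parcs G" if "(u, v) \<in> parcs G" for u v
    using pair_sym_arcs that by (auto simp: symmetric_def sym_def)
  have irr: "(v, v) \<notin> parcs G" for v using pair_no_loops[of "(v, v)"] by auto
  have pc: "proper_colouring (with_proj G) n c \<longleftrightarrow>
      (\<forall>v\<in>pverts G. c v < n) \<and> (\<forall>u\<in>pverts G. \<forall>v\<in>pverts G. (u, v) \<in> parcs G \<longrightarrow> c u \<noteq> c v)" for n c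
    unfolding proper_colouring_def using ends by auto
  have pc_del: "proper_colouring (pre_digraph.del_vert (with_proj G) q) n c \<longleftrightarrow>
      (\<forall>v\<in>pverts G - {q}. c v < n) \<and>
      (\<forall>u\<in>pverts G - {q}. \<forall>v\<in>pverts G - {q}. (u, v) \<in> parcs G \<longrightarrow> c u \<noteq> c v)" for n c q
    unfolding proper_colouring_def pre_digraph.del_vert_def arcs_ends_def arc_to_ends_def
    using ends by fastforce
  have chi: "chromatic_number (with_proj G) = k"
    and chi_del: "\<And>v. v \<in> pverts G \<Longrightarrow> chromatic_number (pre_digraph.del_vert (with_proj G) v) < k"
    using crit unfolding vertex_critical_def by auto
  show ?thesis
  proof
    show "finite (pverts G)" by (rule pair_finite_verts)
    show "u \<in> pverts G" if "(u, v) \<in> parcs G" for u v using ends(1)[OF that] .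
    show "(v, u) \<in> parcs G" if "(u, v) \<in> parcs G" for u v using sym[OF that] .
    show "(v, v) \<notin> parcs G" for v by (rule irr)
    show "\<not> (\<exists>c. (\<forall>v\<in>pverts G. c v < k - 1) \<and>
        (\<forall>u\<in>pverts G. \<forall>v\<in>pverts G. (u, v) \<in> parcs G \<longrightarrow> c u \<noteq> c v))"
    proof
      assume "\<exists>c. (\<forall>v\<in>pverts G. c v < k - 1) \<and>
        (\<forall>u\<in>pverts G. \<forall>v\<in>pverts G. (u, v) \<in> parcs G \<longrightarrow> c u \<noteq> c v)"
      then obtain c where "proper_colouring (with_proj G) (k - 1) c" unfolding pc by blast
      then have "k \<le> k - 1" using chromatic_number_le chi by blast
      then show False using k by simp
    qed
    show "\<exists>c. (\<forall>v\<in>pverts G - {q}. c v < k - 1) \<and>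
        (\<forall>u\<in>pverts G - {q}. \<forall>v\<in>pverts G - {q}. (u, v) \<in> parcs G \<longrightarrow> c u \<noteq> c v)"
      if q: "q \<in> pverts G" for q
    proof -
      let ?H = "pre_digraph.del_vert (with_proj G) q"
      obtain n c where "proper_colouring (with_proj G) n c"
        using proper_colouring_exists[of "with_proj G"] pair_finite_verts loopfree_digraph_axioms by auto
      then have "\<exists>n c. proper_colouring ?H n c" unfolding pc pc_del by blast
      then have "\<exists>c. proper_colouring ?H (chromatic_number ?H) c"
        unfolding chromatic_number_def by (rule LeastI_ex)
      then obtain c where "proper_colouring ?H (chromatic_number ?H) c" by blast
      then have "proper_colouring ?H (k - 1) c"
        by (rule proper_colouring_mono) (use chi_del[OF q] in simp)
      then show ?thesis unfolding pc_del by blast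
    qed
    show False
      if "(a, b) \<in> parcs G" "(b, c) \<in> parcs G" "(c, d) \<in> parcs G" "z \<in> pverts G"
        "(a, c) \<notin> parcs G" "(a, d) \<notin> parcs G" "(b, d) \<notin> parcs G"
        "(a, z) \<notin> parcs G" "(b, z) \<notin> parcs G" "(c, z) \<notin> parcs G" "(d, z) \<notin> parcs G"
      for a b c d z
    proof -
      have ne: "a \<noteq> b" "a \<noteq> c" "a \<noteq> d" "a \<noteq> z" "b \<noteq> c" "b \<noteq> d" "b \<noteq> z" "c \<noteq> d" "c \<noteq> z" "d \<noteq> z"
        using that irr sym by metis+
      define f where "f = (!) [a, b, c, d, z]"
      have f: "f 0 = a" "f (Suc 0) = b" "f 2 = c" "f 3 = d" "f 4 = z" by (simp_all add: f_def)
      note edges = that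
      have reversed: "(b, a) \<in> parcs G" "(c, b) \<in> parcs G" "(d, c) \<in> parcs G"
        "(c, a) \<notin> parcs G" "(d, a) \<notin> parcs G" "(d, b) \<notin> parcs G"
        "(z, a) \<notin> parcs G" "(z, b) \<notin> parcs G" "(z, c) \<notin> parcs G" "(z, d) \<notin> parcs G"
        using that sym by metis+
      have V: "a \<in> pverts G" "b \<in> pverts G" "c \<in> pverts G" "d \<in> pverts G"
        using ends[OF that(1)] ends[OF that(3)] by simp_all
      have "\<not> induced_free (with_proj co_gem) (with_proj G)"
      proof (rule induced_copy[OF wfG, of _ f])
        show "pair_wf_digraph co_gem" using pair_graph_co_gem
          by (simp add: pair_graph_def pair_digraph_def pair_fin_digraph_def)
        show "inj_on f (pverts co_gem)" using ne by (simp add: co_gem_def undirected_def f)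
        show "f ` pverts co_gem \<subseteq> pverts G"
          using V that(4) by (simp add: co_gem_def undirected_def f)
        have "\<forall>u\<in>pverts co_gem. \<forall>v\<in>pverts co_gem.
            (f u, f v) \<in> parcs G \<longleftrightarrow> (u, v) \<in> parcs co_gem"
          by (simp add: co_gem_def undirected_def f edges reversed irr)
        then show "(f u, f v) \<in> parcs G \<longleftrightarrow> (u, v) \<in> parcs co_gem"
          if "u \<in> pverts co_gem" "v \<in> pverts co_gem" for u v
          using that by blast
      qed
      then show False using cg by blast
    qed
    show False
      if "(a, b) \<in> parcs G" "(a, x) \<in> parcs G" "(a, y) \<in> parcs G" "(b, x) \<in> parcs G"
        "(b, y) \<in> parcs G" "(c, x) \<in> parcs G" "(c, y) \<in> parcs G" "x \<noteq> y"
        "(x, y) \<notin> parcs G" "(a, c) \<notin> parcs G" "(b, c) \<notin> parcs G"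
      for a b x y c
    proof -
      have ne: "a \<noteq> b" "a \<noteq> c" "a \<noteq> x" "a \<noteq> y" "b \<noteq> c" "b \<noteq> x" "b \<noteq> y" "c \<noteq> x" "c \<noteq> y"
        using that irr sym by metis+
      define f where "f = (!) [a, b, c, x, y]"
      have f: "f 0 = a" "f (Suc 0) = b" "f 2 = c" "f 3 = x" "f 4 = y" by (simp_all add: f_def)
      note edges = that
      have reversed: "(b, a) \<in> parcs G" "(x, a) \<in> parcs G" "(y, a) \<in> parcs G"
        "(x, b) \<in> parcs G" "(y, b) \<in> parcs G" "(x, c) \<in> parcs G" "(y, c) \<in> parcs G"
        "(y, x) \<notin> parcs G" "(c, a) \<notin> parcs G" "(c, b) \<notin> parcs G"
        using that sym by metis+
      have V: "a \<in> pverts G" "b \<in> pverts G" "c \<in> pverts G" "x \<in> pverts G" "y \<in> pverts G"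
        using ends[OF that(1)] ends[OF that(6)] ends[OF that(7)] by simp_all
      have "\<not> induced_free (with_proj paraglider) (with_proj G)"
      proof (rule induced_copy[OF wfG, of _ f])
        show "pair_wf_digraph paraglider" using pair_graph_paraglider
          by (simp add: pair_graph_def pair_digraph_def pair_fin_digraph_def)
        show "inj_on f (pverts paraglider)" using ne \<open>x \<noteq> y\<close> by (simp add: paraglider_def undirected_def f)
        show "f ` pverts paraglider \<subseteq> pverts G"
          using V by (simp add: paraglider_def undirected_def f)
        have "\<forall>u\<in>pverts paraglider. \<forall>v\<in>pverts paraglider.
            (f u, f v) \<in> parcs G \<longleftrightarrow> (u, v) \<in> parcs paraglider"
          by (simp add: paraglider_def undirected_def f edges reversed irr)
        then show "(f u, f v) \<in> parcs G \<longleftrightarrow> (u, v) \<in> parcs paraglider"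
          if "u \<in> pverts paraglider" "v \<in> pverts paraglider" for u v
          using that by blast
      qed
      then show False using pg by blast
    qed
    show "Suc (k - 1) < card (pverts G)" using k large by simp
  qed
qed

text \<open>
  Every such graph has a copy whose vertices are natural numbers below \<open>N\<close>.
\<close>
lemma finitely_many_of_bounded_order:
  "\<exists>F :: nat pair_pre_digraph set. finite F \<and>
    (\<forall>G :: 'a pair_pre_digraph. pair_graph G \<and> card (pverts G) \<le> N \<longrightarrow>
      (\<exists>H \<in> F. pair_graph H \<and> digraph_iso (with_proj G) (with_proj H)))"
proof (intro exI conjI allI impI)
  let ?F = "(\<lambda>(V, E). \<lparr>pverts = V, parcs = E\<rparr>) ` (Pow {..<N} \<times> Pow ({..<N} \<times> {..<N}))"
  show "finite ?F" by simp
  fix G :: "'a pair_pre_digraph"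
  assume "pair_graph G \<and> card (pverts G) \<le> N"
  then have G: "pair_graph G" and N: "card (pverts G) \<le> N" by auto
  interpret pair_graph G by fact
  obtain f where f: "bij_betw f (pverts G) {0..<card (pverts G)}"
    using ex_bij_betw_finite_nat[OF pair_finite_verts] by blast
  have inj: "inj_on f (pverts G)" using f by (simp add: bij_betw_def)
  have sub: "f ` pverts G \<subseteq> {..<N}" using f N by (auto simp: bij_betw_def)
  let ?H = "\<lparr>pverts = f ` pverts G, parcs = map_prod f f ` parcs G\<rparr>"
  have ends: "u \<in> pverts G" "v \<in> pverts G" if "(u, v) \<in> parcs G" for u v
    using arc_fst_in_verts[OF that] arc_snd_in_verts[OF that] by auto
  have sym: "(v, u) \<in> parcs G" if "(u, v) \<in> parcs G" for u v
    using pair_sym_arcs that by (auto simp: symmetric_def sym_def)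
  have irr: "(v, v) \<notin> parcs G" for v using pair_no_loops[of "(v, v)"] by auto
  have "pair_graph ?H"
  proof
    show "finite (pverts ?H)" "finite (parcs ?H)"
      using pair_finite_verts pair_finite_arcs by simp_all
    show "symmetric (with_proj ?H)"
      using sym by (force simp: symmetric_def sym_def)
    show "fst e \<noteq> snd e" if "e \<in> parcs ?H" for e
    proof
      assume eq: "fst e = snd e"
      obtain u v where uv: "(u, v) \<in> parcs G" "e = (f u, f v)" using \<open>e \<in> parcs ?H\<close> by auto
      then have "u = v" using eq inj ends[OF uv(1)] by (auto simp: inj_on_eq_iff)
      then show False using uv(1) irr by simp
    qed
  qed (use ends in auto)
  moreover have "map_prod f f ` parcs G \<subseteq> {..<N} \<times> {..<N}" 
  proof (rule image_subsetI)
    fix e assume "e \<in> parcs G"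
    then show "map_prod f f e \<in> {..<N} \<times> {..<N}" using sub ends[of "fst e" "snd e"] by (cases e) auto
  qed
  then have "?H \<in> ?F"
    using sub by (intro image_eqI[of _ _ "(f ` pverts G, map_prod f f ` parcs G)"]) auto
  moreover have "digraph_iso (with_proj G) (with_proj ?H)"
    using inj by (intro digraph_iso_map) unfold_locales
  ultimately show "\<exists>H \<in> ?F. pair_graph H \<and> digraph_iso (with_proj G) (with_proj H)" by blast
qed

theorem theorem1:
  fixes k :: nat
  assumes "1 \<le> k"
  shows "\<exists>F :: nat pair_pre_digraph set. finite F \<and>
    (\<forall>G :: 'a pair_pre_digraph.
       pair_graph G \<and> vertex_critical k (with_proj G) \<and>
       induced_free (with_proj co_gem) (with_proj G) \<and>
       induced_free (with_proj paraglider) (with_proj G) \<longrightarrow>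
       (\<exists>H \<in> F. pair_graph H \<and> digraph_iso (with_proj G) (with_proj H)))"
proof -
  \<comment> \<open>Graphs on at most \<open>k\<close> vertices, such as the complete graph, are covered by \<open>max k\<close>.\<close>
  define N where "N = max k (ES 2 (Suc (k - 1)) ((step_bound (k - 1) ^^ (k - 1)) 1))"
  have "card (pverts G) \<le> N"
    if "pair_graph G" "vertex_critical k (with_proj G)" "induced_free (with_proj co_gem) (with_proj G)"
      "induced_free (with_proj paraglider) (with_proj G)" for G :: "'a pair_pre_digraph"
  proof (cases "k < card (pverts G)")
    case True
    then show ?thesis
      using critical_graph.card_V_less[OF critical_graph_of_vertex_critical[OF assms that True]]
      by (simp add: N_def)
  next
    case False
    then show ?thesis by (simp add: N_def)
  qed
  then show ?thesis using finitely_many_of_bounded_order[of N] by meson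
qed

end
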